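(* Let $\mathcal{N}$ be the network with source $S$, intermediate vertices $V_1,\dots,V_6$, five terminals $T_1,\dots,T_5$, and exactly the following edges (one each): $S\to V_1$, $S\to V_2$; $V_1\to V_3$, $V_2\to V_3$; $V_1\to V_4$, $V_2\to V_4$; $V_3\to V_5$; $V_4\to V_6$; $V_1\to T_1$, $V_5\to T_1$; $V_1\to T_2$, $V_6\to T_2$; $V_5\to T_3$, $V_6\to T_3$; $V_2\to T_4$, $V_5\to T_4$; $V_2\to T_5$, $V_6\to T_5$. Then for every alphabet $\mathcal{A}$ (finite set with $|\mathcal{A}|\ge 2$) $$\mathrm{C}_1(\mathcal{N},\mathcal{A})=\begin{cases}1 & \text{if } |\mathcal{A}|=2,\\ \log_6 34 & \text{if } |\mathcal{A}|=6,\\ 2 & \text{otherwise.}\end{cases}$$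
   Context: A (single-source) network is a tuple $\mathcal{N}=(\mathcal{V},\mathcal{E},S,\mathbf{T})$ where $(\mathcal{V},\mathcal{E})$ is a finite directed acyclic multigraph, $S\in\mathcal{V}$ is the source, $\mathbf{T}\subseteq\mathcal{V}\setminus\{S\}$ is a nonempty set of terminals, the source has no incoming edges, terminals have no outgoing edges, there is a directed path from $S$ to every terminal, and every other (intermediate) vertex lies on a directed path from $S$ to it and has a directed path to some terminal. $\mathrm{in}(V)$ and $\mathrm{out}(V)$ denote the sets of incoming and outgoing edges of $V$. An alphabet $\mathcal{A}$ is a finite set with at least 2 elements; each edge carries exactly one symbol of $\mathcal{A}$. The edges are totally ordered by some fixed total order extending the partial order "$e\preccurlyeq e'$ if there is a directed path starting with $e$ and ending with $e'$" (the choice of extension does not matter), and this is used to index coordinates. A network code for $(\mathcal{N},\mathcal{A})$ is a family $\mathcal{F}=\{\mathcal{F}_V\}$, indexed by the intermediate vertices, of functions $\mathcal{F}_V:\mathcal{A}^{|\mathrm{in}(V)|}\to\mathcal{A}^{|\mathrm{out}(V)|}$. For a terminal $T$, $\Omega[\mathcal{N},\mathcal{F},S\to T]:\mathcal{A}^{|\mathrm{out}(S)|}\to\mathcal{A}^{|\mathrm{in}(T)|}$ is the function that sends the vector of symbols emitted by $S$ on its outgoing edges to the vector of symbols arriving on the incoming edges of $T$ when every intermediate vertex $V$ applies $\mathcal{F}_V$ to its incoming symbols. An outer code is a nonempty subset $\mathcal{C}\subseteq\mathcal{A}^{|\mathrm{out}(S)|}$. The pair $(\mathcal{C},\mathcal{F})$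 is unambiguous for $(\mathcal{N},\mathcal{A})$ if for every $T\in\mathbf{T}$ the function $\Omega[\mathcal{N},\mathcal{F},S\to T]$ is injective on $\mathcal{C}$. The (1-shot) capacity is $\mathrm{C}_1(\mathcal{N},\mathcal{A})=\max\{\log_{|\mathcal{A}|}|\mathcal{C}| : (\mathcal{C},\mathcal{F})\text{ is unambiguous for }(\mathcal{N},\mathcal{A})\text{ for some network code }\mathcal{F}\}$. *)

theory Defs
  imports Complex_Main "HOL-Library.FuncSet" "Graph_Theory.Digraph"
begin

section \<open>Single-source networks\<close>

record ('v, 'e) network =
  graph :: "('v, 'e) pre_digraph"
  source :: 'v
  terminals :: "'v set"

definition intermediate :: "('v, 'e) network \<Rightarrow> 'v set" where
  "intermediate N = verts (graph N) - insert (source N) (terminals N)"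

definition is_network :: "('v, 'e) network \<Rightarrow> bool" where
  "is_network N \<longleftrightarrow>
     fin_digraph (graph N) \<and> acyclic (arcs_ends (graph N)) \<and>
     source N \<in> verts (graph N) \<and>
     terminals N \<subseteq> verts (graph N) - {source N} \<and> terminals N \<noteq> {} \<and>
     in_arcs (graph N) (source N) = {} \<and>
     (\<forall>T \<in> terminals N. out_arcs (graph N) T = {}) \<and>
     (\<forall>T \<in> terminals N. source N \<rightarrow>\<^sup>*\<^bsub>graph N\<^esub> T) \<and>
     (\<forall>V \<in> intermediate N. source N \<rightarrow>\<^sup>*\<^bsub>graph N\<^esub> V \<and>
        (\<exists>T \<in> terminals N. V \<rightarrow>\<^sup>*\<^bsub>graph N\<^esub> T))"


section \<open>Network codes\<close>

text \<open>
  A vector with one coordinate per edge of an edge set \<open>E\<close> is an element of \<open>E \<rightarrow>\<^sub>E A\<close>, that is,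
  a family indexed by the edges themselves. Listing the coordinates by means of a total order of
  the edges identifies \<open>E \<rightarrow>\<^sub>E A\<close> with the tuples of length \<open>card E\<close>; no order is needed here.
\<close>

definition network_codes ::
    "('v, 'e) network \<Rightarrow> 'a set \<Rightarrow> ('v \<Rightarrow> ('e \<Rightarrow> 'a) \<Rightarrow> 'e \<Rightarrow> 'a) set" where
  "network_codes N A =
     (\<Pi>\<^sub>E V \<in> intermediate N. (in_arcs (graph N) V \<rightarrow>\<^sub>E A) \<rightarrow>\<^sub>E (out_arcs (graph N) V \<rightarrow>\<^sub>E A))"

text \<open>
  \<open>carries N F x w\<close>: if the source emits \<open>x\<close> and the intermediate vertices apply \<open>F\<close>,
  then every edge \<open>e\<close> carries the symbol \<open>w e\<close>.
\<close>

definition carries ::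
    "('v, 'e) network \<Rightarrow> ('v \<Rightarrow> ('e \<Rightarrow> 'a) \<Rightarrow> 'e \<Rightarrow> 'a) \<Rightarrow> ('e \<Rightarrow> 'a) \<Rightarrow> ('e \<Rightarrow> 'a) \<Rightarrow> bool" where
  "carries N F x w \<longleftrightarrow>
     w \<in> extensional (arcs (graph N)) \<and>
     (\<forall>e \<in> out_arcs (graph N) (source N). w e = x e) \<and>
     (\<forall>V \<in> intermediate N. \<forall>e \<in> out_arcs (graph N) V.
        w e = F V (restrict w (in_arcs (graph N) V)) e)"

text \<open>On a network the description is unique, by \<open>ex1_carries\<close> below.\<close>

definition edge_symbols ::
    "('v, 'e) network \<Rightarrow> ('v \<Rightarrow> ('e \<Rightarrow> 'a) \<Rightarrow> 'e \<Rightarrow> 'a) \<Rightarrow> ('e \<Rightarrow> 'a) \<Rightarrow> ('e \<Rightarrow> 'a)" where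
  "edge_symbols N F x = (THE w. carries N F x w)"

definition transfer ::
    "('v, 'e) network \<Rightarrow> ('v \<Rightarrow> ('e \<Rightarrow> 'a) \<Rightarrow> 'e \<Rightarrow> 'a) \<Rightarrow> 'v \<Rightarrow> ('e \<Rightarrow> 'a) \<Rightarrow> ('e \<Rightarrow> 'a)" where
  "transfer N F T = (\<lambda>x. restrict (edge_symbols N F x) (in_arcs (graph N) T))"

definition outer_code :: "('v, 'e) network \<Rightarrow> 'a set \<Rightarrow> ('e \<Rightarrow> 'a) set \<Rightarrow> bool" where
  "outer_code N A C \<longleftrightarrow> C \<noteq> {} \<and> C \<subseteq> (out_arcs (graph N) (source N) \<rightarrow>\<^sub>E A)"

definition unambiguous ::
    "('v, 'e) network \<Rightarrow> 'a set \<Rightarrow> ('e \<Rightarrow> 'a) set \<Rightarrow> ('v \<Rightarrow> ('e \<Rightarrow> 'a) \<Rightarrow> 'e \<Rightarrow> 'a) \<Rightarrow> bool" where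
  "unambiguous N A C F \<longleftrightarrow>
     outer_code N A C \<and> F \<in> network_codes N A \<and> (\<forall>T \<in> terminals N. inj_on (transfer N F T) C)"

definition achievable_rates :: "('v, 'e) network \<Rightarrow> 'a set \<Rightarrow> real set" where
  "achievable_rates N A = {log (card A) (card C) | C. \<exists>F. unambiguous N A C F}"

definition capacity :: "('v, 'e) network \<Rightarrow> 'a set \<Rightarrow> real" where
  "capacity N A = Max (achievable_rates N A)"


section \<open>Well-definedness\<close>

lemma ex1_carries:
  assumes "is_network N"
  shows "\<exists>!w. carries N F x w"
proof -
  let ?G = "graph N"
  interpret fin_digraph ?G using assms by (simp add: is_network_def)
  define R where "R = {(e', e). e' \<in> arcs ?G \<and> e \<in> arcs ?G \<and> head ?G e' = tail ?G e}"
  have "finite (arcs_ends ?G)" by (simp add: arcs_ends_def)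
  with assms have "wf (arcs_ends ?G)" by (simp add: is_network_def finite_acyclic_wf)
  then have "wf (inv_image (arcs_ends ?G) (tail ?G))" by (rule wf_inv_image)
  moreover have "R \<subseteq> inv_image (arcs_ends ?G) (tail ?G)"
    by (force simp: R_def arcs_ends_conv)
  ultimately have wf: "wf R" by (rule wf_subset)
  define H where "H = (\<lambda>w e. if tail ?G e = source N then x e
     else F (tail ?G e) (restrict w (in_arcs ?G (tail ?G e))) e)"
  have tails: "tail ?G e = source N \<or> tail ?G e \<in> intermediate N" if "e \<in> arcs ?G" for e
    using assms that by (auto simp: is_network_def intermediate_def out_arcs_def)
  have not_int: "source N \<notin> intermediate N" by (simp add: intermediate_def)
  have carries_iff: "carries N F x w \<longleftrightarrow>
      w \<in> extensional (arcs ?G) \<and> (\<forall>e \<in> arcs ?G. w e = H w e)" for w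
    using tails not_int unfolding carries_def H_def by fastforce
  define u where "u = wfrec R H"
  have u: "u e = H (cut u R e) e" for e
    unfolding u_def by (rule wfrec[OF wf])
  have H_cong: "H w e = H w' e" if "e \<in> arcs ?G" "\<And>e'. (e', e) \<in> R \<Longrightarrow> w e' = w' e'" for w w' e
  proof -
    have "restrict w (in_arcs ?G (tail ?G e)) = restrict w' (in_arcs ?G (tail ?G e))"
      using that by (auto simp: R_def fun_eq_iff)
    then show ?thesis by (simp add: H_def)
  qed
  show ?thesis
  proof (rule ex1I)
    show "carries N F x (restrict u (arcs ?G))"
      unfolding carries_iff
    proof (intro conjI ballI)
      fix e assume e: "e \<in> arcs ?G"
      have "restrict u (arcs ?G) e = H (cut u R e) e" using e u by simp
      also have "\<dots> = H (restrict u (arcs ?G)) e"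
        by (rule H_cong[OF e]) (auto simp: cut_def R_def)
      finally show "restrict u (arcs ?G) e = H (restrict u (arcs ?G)) e" .
    qed simp
  next
    fix w assume "carries N F x w"
    then have ext: "w \<in> extensional (arcs ?G)" and w: "\<And>e. e \<in> arcs ?G \<Longrightarrow> w e = H w e"
      by (auto simp: carries_iff)
    have "e \<in> arcs ?G \<longrightarrow> w e = u e" for e
      using wf
    proof (induction e rule: wf_induct_rule)
      case (less e)
      show ?case
      proof
        assume e: "e \<in> arcs ?G"
        have "w e = H w e" by (rule w[OF e])
        also have "\<dots> = H (cut u R e) e"
          by (rule H_cong[OF e]) (use less in \<open>auto simp: cut_def R_def\<close>)
        finally show "w e = u e" by (simp add: u)
      qed
    qed
    with ext show "w = restrict u (arcs ?G)"
      by (auto simp: fun_eq_iff extensional_def)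
  qed
qed

lemma carries_edge_symbols:
  assumes "is_network N"
  shows "carries N F x (edge_symbols N F x)"
  unfolding edge_symbols_def by (rule theI'[OF ex1_carries[OF assms]])

lemma achievable_rates_finite:
  assumes "is_network N" "finite A"
  shows "finite (achievable_rates N A)"
proof -
  interpret fin_digraph "graph N" using assms by (simp add: is_network_def)
  let ?X = "out_arcs (graph N) (source N) \<rightarrow>\<^sub>E A"
  have "finite ?X" using assms(2) by (intro finite_PiE finite_out_arcs) auto
  then have "finite ((\<lambda>C. log (card A) (card C)) ` Pow ?X)" by simp
  moreover have "achievable_rates N A \<subseteq> (\<lambda>C. log (card A) (card C)) ` Pow ?X"
    by (auto simp: achievable_rates_def unambiguous_def outer_code_def)
  ultimately show ?thesis by (rule rev_finite_subset)
qed

lemma achievable_rates_nonempty: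
  assumes "A \<noteq> {}"
  shows "achievable_rates N A \<noteq> {}"
proof -
  from assms obtain a where a: "a \<in> A" by blast
  define x where "x = restrict (\<lambda>_. a) (out_arcs (graph N) (source N))"
  define F where "F = restrict (\<lambda>V. restrict (\<lambda>_. restrict (\<lambda>_. a) (out_arcs (graph N) V))
      (in_arcs (graph N) V \<rightarrow>\<^sub>E A)) (intermediate N)"
  have "F \<in> network_codes N A"
    unfolding network_codes_def F_def using a by (intro restrict_PiE_iff[THEN iffD2]) auto
  then have "unambiguous N A {x} F"
    using a by (auto simp: unambiguous_def outer_code_def x_def)
  then show ?thesis by (auto simp: achievable_rates_def)
qed


section \<open>The network with five terminals\<close>

datatype vertex = S | V1 | V2 | V3 | V4 | V5 | V6 | T1 | T2 | T3 | T4 | T5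

definition net5 :: "(vertex, vertex \<times> vertex) network" where
  "net5 =
    \<lparr> graph = \<lparr> verts = {S, V1, V2, V3, V4, V5, V6, T1, T2, T3, T4, T5},
        arcs = {(S, V1), (S, V2),
                (V1, V3), (V2, V3), (V1, V4), (V2, V4),
                (V3, V5), (V4, V6),
                (V1, T1), (V5, T1),
                (V1, T2), (V6, T2),
                (V5, T3), (V6, T3),
                (V2, T4), (V5, T4),
                (V2, T5), (V6, T5)},
        tail = fst, head = snd \<rparr>,
      source = S,
      terminals = {T1, T2, T3, T4, T5} \<rparr>"

lemma intermediate_net5: "intermediate net5 = {V1, V2, V3, V4, V5, V6}"
  by (auto simp: intermediate_def net5_def)

lemma is_network_net5: "is_network net5"
proof -
  let ?G = "graph net5"
  have fin: "fin_digraph ?G"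
    by unfold_locales (auto simp: net5_def)
  interpret fin_digraph ?G by (rule fin)
  have ends: "arcs_ends ?G = arcs ?G" by (auto simp: arcs_ends_conv net5_def)
  define rank :: "vertex \<Rightarrow> nat" where
    "rank v = (case v of S \<Rightarrow> 0 | V1 \<Rightarrow> 1 | V2 \<Rightarrow> 1 | V3 \<Rightarrow> 2 | V4 \<Rightarrow> 2 | V5 \<Rightarrow> 3 | V6 \<Rightarrow> 3 | _ \<Rightarrow> 4)"
    for v
  have "arcs_ends ?G \<subseteq> Wellfounded.measure rank"
    unfolding ends by (auto simp: net5_def rank_def)
  then have acyclic: "acyclic (arcs_ends ?G)"
    using wf_measure wf_subset wf_acyclic by blast
  have step: "u \<rightarrow>\<^bsub>?G\<^esub> v" if "(u, v) \<in> arcs ?G" for u v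
    using that by (simp add: ends)
  have d: "S \<rightarrow>\<^bsub>?G\<^esub> V1" "S \<rightarrow>\<^bsub>?G\<^esub> V2" "V1 \<rightarrow>\<^bsub>?G\<^esub> V3" "V1 \<rightarrow>\<^bsub>?G\<^esub> V4" "V3 \<rightarrow>\<^bsub>?G\<^esub> V5"
    "V4 \<rightarrow>\<^bsub>?G\<^esub> V6" "V1 \<rightarrow>\<^bsub>?G\<^esub> T1" "V1 \<rightarrow>\<^bsub>?G\<^esub> T2" "V5 \<rightarrow>\<^bsub>?G\<^esub> T3" "V6 \<rightarrow>\<^bsub>?G\<^esub> T3"
    "V2 \<rightarrow>\<^bsub>?G\<^esub> T4" "V2 \<rightarrow>\<^bsub>?G\<^esub> T5"
    by (rule step, simp add: net5_def)+
  have from_S: "S \<rightarrow>\<^sup>*\<^bsub>?G\<^esub> V" if "V \<in> {V1, V2, V3, V4, V5, V6, T1, T2, T3, T4, T5}" for V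
  proof -
    have 1: "S \<rightarrow>\<^sup>*\<^bsub>?G\<^esub> V1" "S \<rightarrow>\<^sup>*\<^bsub>?G\<^esub> V2" using d by auto
    then have 2: "S \<rightarrow>\<^sup>*\<^bsub>?G\<^esub> V3" "S \<rightarrow>\<^sup>*\<^bsub>?G\<^esub> V4" using d reachable_adj_trans by metis+
    then have 3: "S \<rightarrow>\<^sup>*\<^bsub>?G\<^esub> V5" "S \<rightarrow>\<^sup>*\<^bsub>?G\<^esub> V6" using d reachable_adj_trans by metis+
    have 4: "S \<rightarrow>\<^sup>*\<^bsub>?G\<^esub> T1" "S \<rightarrow>\<^sup>*\<^bsub>?G\<^esub> T2" "S \<rightarrow>\<^sup>*\<^bsub>?G\<^esub> T3" "S \<rightarrow>\<^sup>*\<^bsub>?G\<^esub> T4" "S \<rightarrow>\<^sup>*\<^bsub>?G\<^esub> T5"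
      using d 1 3 reachable_adj_trans by metis+
    show ?thesis using that 1 2 3 4 by auto
  qed
  have to_T: "\<exists>T \<in> {T1, T2, T3, T4, T5}. V \<rightarrow>\<^sup>*\<^bsub>?G\<^esub> T" if "V \<in> {V1, V2, V3, V4, V5, V6}" for V
  proof -
    have 1: "V1 \<rightarrow>\<^sup>*\<^bsub>?G\<^esub> T1" "V2 \<rightarrow>\<^sup>*\<^bsub>?G\<^esub> T4" "V5 \<rightarrow>\<^sup>*\<^bsub>?G\<^esub> T3" "V6 \<rightarrow>\<^sup>*\<^bsub>?G\<^esub> T3" using d by auto
    then have "V3 \<rightarrow>\<^sup>*\<^bsub>?G\<^esub> T3" "V4 \<rightarrow>\<^sup>*\<^bsub>?G\<^esub> T3" using d adj_reachable_trans by metis+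
    with 1 that show ?thesis by auto
  qed
  have source: "source net5 = S" and terminals: "terminals net5 = {T1, T2, T3, T4, T5}"
    by (simp_all add: net5_def)
  show ?thesis
    unfolding is_network_def intermediate_net5 source terminals
  proof (intro conjI)
    show "\<forall>T\<in>{T1, T2, T3, T4, T5}. S \<rightarrow>\<^sup>*\<^bsub>?G\<^esub> T" using from_S by simp
    show "\<forall>V\<in>{V1, V2, V3, V4, V5, V6}. S \<rightarrow>\<^sup>*\<^bsub>?G\<^esub> V \<and> (\<exists>T\<in>{T1, T2, T3, T4, T5}. V \<rightarrow>\<^sup>*\<^bsub>?G\<^esub> T)"
      using from_S to_T by simp
  qed (use fin acyclic in \<open>auto simp: net5_def in_arcs_def out_arcs_def\<close>)
qed

end

(*
  Vertices V1 and V2 can forward the symbols x, y of the two source edges unchanged, so everything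
  depends on the symbols f, g on the edges V3 -> V5 and V4 -> V6. The terminals require that any two
  of x, y, f, g, except possibly x, y, determine the codeword, and x, y do so anyway: the outer codes
  are the codes of length 4 and minimum distance 3. Size n^2 means a pair of orthogonal Latin squares
  of order n.

  Such squares exist for n other than 2 and 6: they are cyclic for odd n; for even n >= 58
  Wilson's construction applied to n = 3 t + u with t coprime to 6 and u <= t odd produces them; the
  smaller even orders follow from Wilson's construction, products, and explicit arrays of order
  4, 8, 10 and 14.

  For n = 6 a code of size 34 is given, one of size 35 would extend to one of size 36, and size 36 is
  refuted by a variant of Stinson's proof of Tarry's theorem. Consider the incidence matrix over GF(2)
  of the 24 points (column, symbol) and the 36 rows. Orthogonality of its row space to a large subspace
  of itself yields more linear relations between the points than the 8 evident ones. Counting then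
  produces a relation with two points in each column that meets every row in 0 or 2 points, and the
  12 rows that avoid it form a 4 x 4 configuration that a small search excludes.
*)
theory Submission
  imports Defs
begin

section \<open>Packings and orthogonal arrays\<close>

text \<open>The exceptional role of order 6 comes from a dimension count over GF(2). A point lies on
  6 rows, two points of one column share no row, and points of different columns share exactly one.
  So a sum with an even number of points in every column is orthogonal to all 24 points. If the
  relations have dimension r, the points span dimension 24 - r, and the even sums, of dimension 20
  before relations are divided out, span at least 20 - r. Orthogonal subspaces of a space of
  dimension 36 satisfy (24 - r) + (20 - r) <= 36, hence r >= 4. The evident relations, sums of an
  even number of full columns, account for only 3. In order 10 the same inequality reads (40 - r) +
  (36 - r) <= 100 and says nothing. Vectors over GF(2) are represented by finite sets with symmetric
  difference as addition, and dimensions by cardinalities.\<close>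

text \<open>
  The rows \<open>w r\<close> of a packing are the words of a code of length \<open>k\<close> and minimum distance at least
  \<open>k - 1\<close>, indexed by \<open>r \<in> R\<close>; those of an orthogonal array are an MDS code.
\<close>

definition packing :: "nat \<Rightarrow> 'a set \<Rightarrow> 'r set \<Rightarrow> ('r \<Rightarrow> nat \<Rightarrow> 'a) \<Rightarrow> bool" where
  "packing k A R w \<longleftrightarrow> (\<forall>r\<in>R. \<forall>i<k. w r i \<in> A) \<and>
     (\<forall>i<k. \<forall>j<k. i \<noteq> j \<longrightarrow> inj_on (\<lambda>r. (w r i, w r j)) R)"

definition OA :: "nat \<Rightarrow> 'a set \<Rightarrow> 'r set \<Rightarrow> ('r \<Rightarrow> nat \<Rightarrow> 'a) \<Rightarrow> bool" where
  "OA k A R w \<longleftrightarrow> (\<forall>r\<in>R. \<forall>i<k. w r i \<in> A) \<and>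
     (\<forall>i<k. \<forall>j<k. i \<noteq> j \<longrightarrow> bij_betw (\<lambda>r. (w r i, w r j)) R (A \<times> A))"

text \<open>Symbols and rows get fixed concrete types because a definition cannot quantify over
  types. \<open>has_OA_I\<close> and \<open>has_OA_E\<close> lead from and to other symbol
  sets.\<close>

definition has_OA :: "nat \<Rightarrow> nat \<Rightarrow> bool" where
  "has_OA k n \<longleftrightarrow>
     (\<exists>w :: nat \<times> nat \<Rightarrow> nat \<Rightarrow> nat. OA k {..<n} ({..<n} \<times> {..<n}) w)"

lemma packing_mem: "packing k A R w \<Longrightarrow> r \<in> R \<Longrightarrow> i < k \<Longrightarrow> w r i \<in> A"
  by (simp add: packing_def)

lemma packing_eq:
  assumes "packing k A R w" "i < k" "j < k" "i \<noteq> j" "r \<in> R" "r' \<in> R"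
    "w r i = w r' i" "w r j = w r' j"
  shows "r = r'"
  using assms unfolding packing_def inj_on_def by blast

lemma packingI:
  assumes "\<And>r i. r \<in> R \<Longrightarrow> i < k \<Longrightarrow> w r i \<in> A"
    and "\<And>i j r r'. \<lbrakk>i < j; j < k; r \<in> R; r' \<in> R; w r i = w r' i; w r j = w r' j\<rbrakk> \<Longrightarrow> r = r'"
  shows "packing k A R w"
  unfolding packing_def inj_on_def using assms by (metis Pair_inject linorder_neqE_nat)

lemma OA_imp_packing: "OA k A R w \<Longrightarrow> packing k A R w"
  by (auto simp: OA_def packing_def bij_betw_def)

lemma packing_card_le:
  assumes "packing k A R w" "2 \<le> k" "finite A"
  shows "finite R" "card R \<le> (card A)\<^sup>2"
proof -
  have inj: "inj_on (\<lambda>r. (w r 0, w r 1)) R" and sub: "(\<lambda>r. (w r 0, w r 1)) ` R \<subseteq> A \<times> A"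
    using assms(1,2) by (auto simp: packing_def)
  show "finite R"
    using inj sub assms(3) by (meson finite_SigmaI inj_on_finite)
  show "card R \<le> (card A)\<^sup>2"
    using card_inj_on_le[OF inj sub] assms(3) by (simp add: card_cartesian_product power2_eq_square)
qed

lemma packing_imp_OA:
  assumes "packing k A R w" "finite A" "card R = (card A)\<^sup>2"
  shows "OA k A R w"
  unfolding OA_def
proof (intro conjI allI impI)
  show "\<forall>r\<in>R. \<forall>i<k. w r i \<in> A" using assms(1) by (simp add: packing_def)
  fix i j assume ij: "i < k" "j < k" "i \<noteq> j"
  let ?f = "\<lambda>r. (w r i, w r j)"
  have inj: "inj_on ?f R" and sub: "?f ` R \<subseteq> A \<times> A"
    using assms(1) ij by (auto simp: packing_def)
  have "card (?f ` R) = card (A \<times> A)"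
    using assms(3) inj by (simp add: card_image card_cartesian_product power2_eq_square)
  then have "?f ` R = A \<times> A"
    using sub assms(2) by (intro card_subset_eq) auto
  then show "bij_betw ?f R (A \<times> A)" using inj by (simp add: bij_betw_def)
qed

lemma OA_mem: "OA k A R w \<Longrightarrow> r \<in> R \<Longrightarrow> i < k \<Longrightarrow> w r i \<in> A"
  by (simp add: OA_def)

lemma OA_ex:
  assumes "OA k A R w" "i < k" "j < k" "i \<noteq> j" "a \<in> A" "b \<in> A"
  obtains r where "r \<in> R" "w r i = a" "w r j = b"
proof -
  have "(a, b) \<in> (\<lambda>r. (w r i, w r j)) ` R"
    using assms unfolding OA_def bij_betw_def by blast
  then show ?thesis using that by auto
qed

lemma OA_finite_card:
  assumes "OA k A R w" "2 \<le> k" "finite A"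
  shows "finite R" "card R = (card A)\<^sup>2"
proof -
  have "0 < k" "1 < k" using assms(2) by auto
  then have "bij_betw (\<lambda>r. (w r 0, w r 1)) R (A \<times> A)"
    using assms(1) unfolding OA_def by auto
  then show "finite R" "card R = (card A)\<^sup>2"
    using assms(3)
    by (auto simp: bij_betw_finite card_cartesian_product power2_eq_square dest: bij_betw_same_card)
qed

lemma OA_relabel:
  assumes "OA k A R w" "\<And>i. i < k \<Longrightarrow> bij_betw (g i) A B"
  shows "OA k B R (\<lambda>r i. g i (w r i))"
  unfolding OA_def
proof (intro conjI allI impI ballI)
  show "g i (w r i) \<in> B" if "r \<in> R" "i < k" for r i
    using bij_betwE[OF assms(2)] OA_mem[OF assms(1)] that by blast
  fix i j assume ij: "i < k" "j < k" "i \<noteq> j"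
  have "bij_betw (\<lambda>r. (w r i, w r j)) R (A \<times> A)" using assms(1) ij by (simp add: OA_def)
  moreover have "bij_betw (map_prod (g i) (g j)) (A \<times> A) (B \<times> B)"
    using assms(2) ij by (intro bij_betw_map_prod) auto
  ultimately have "bij_betw (map_prod (g i) (g j) \<circ> (\<lambda>r. (w r i, w r j))) R (B \<times> B)"
    by (rule bij_betw_trans)
  then show "bij_betw (\<lambda>r. (g i (w r i), g j (w r j))) R (B \<times> B)" by (simp add: o_def)
qed

lemma OA_reindex:
  assumes "OA k A R w" "bij_betw h R' R"
  shows "OA k A R' (w \<circ> h)"
  unfolding OA_def
proof (intro conjI allI impI ballI)
  show "(w \<circ> h) r i \<in> A" if "r \<in> R'" "i < k" for r i
    using bij_betwE[OF assms(2)] OA_mem[OF assms(1)] that by auto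
  fix i j assume ij: "i < k" "j < k" "i \<noteq> j"
  have "bij_betw (\<lambda>r. (w r i, w r j)) R (A \<times> A)" using assms(1) ij by (simp add: OA_def)
  from bij_betw_trans[OF assms(2) this]
  show "bij_betw (\<lambda>r. ((w \<circ> h) r i, (w \<circ> h) r j)) R' (A \<times> A)" by (simp add: o_def)
qed

lemma has_OA_I:
  assumes "OA k A R w" "2 \<le> k" "finite A" "card A = n"
  shows "has_OA k n"
proof -
  obtain g where g: "bij_betw g A {..<n}"
    using assms(3,4) finite_same_card_bij[of A "{..<n}"] by auto
  have "finite R" "card R = card ({..<n} \<times> {..<n})"
    using OA_finite_card[OF assms(1-3)] assms(4) by (simp_all add: power2_eq_square)
  then obtain h where h: "bij_betw h ({..<n} \<times> {..<n}) R"
    by (metis finite_SigmaI finite_lessThan finite_same_card_bij)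
  show ?thesis
    using OA_reindex[OF OA_relabel[OF assms(1) g] h] unfolding has_OA_def by blast
qed

lemma has_OA_E:
  assumes "has_OA k n" "finite A" "card A = n"
  obtains w :: "nat \<times> nat \<Rightarrow> nat \<Rightarrow> 'a" where "OA k A ({..<n} \<times> {..<n}) w"
proof -
  obtain w :: "nat \<times> nat \<Rightarrow> nat \<Rightarrow> nat" where w: "OA k {..<n} ({..<n} \<times> {..<n}) w"
    using assms(1) by (auto simp: has_OA_def)
  obtain g where g: "bij_betw g {..<n} A"
    using assms(2,3) finite_same_card_bij[of "{..<n}" A] by auto
  show ?thesis using that OA_relabel[OF w g] by blast
qed

lemma has_OA_packing:
  assumes "packing k A R w" "2 \<le> k" "finite A" "card A = n" "card R = n\<^sup>2"
  shows "has_OA k n"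
  using packing_imp_OA[OF assms(1,3)] assms has_OA_I by blast

lemma bij_with_value:
  assumes "finite A" "finite B" "card A = card B" "a \<in> A" "b \<in> B"
  obtains g where "bij_betw g A B" "g a = b"
proof -
  obtain g where g: "bij_betw g (A - {a}) (B - {b})"
    using assms finite_same_card_bij[of "A - {a}" "B - {b}"] by auto
  have "bij_betw (g(a := b)) (insert a (A - {a})) (insert b (B - {b}))"
    using g unfolding bij_betw_def by (auto simp: inj_on_def)
  then show ?thesis using that[of "g(a := b)"] assms by (simp add: insert_absorb)
qed

text \<open>Permuting the symbols of each column separately preserves the array, so any one row can
  be made constant.\<close>

lemma has_OA_pointed:
  assumes "has_OA k n" "finite A" "card A = n" "a \<in> A"
  obtains w :: "nat \<times> nat \<Rightarrow> nat \<Rightarrow> 'a" and r where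
    "OA k A ({..<n} \<times> {..<n}) w" "r \<in> {..<n} \<times> {..<n}" "\<And>i. i < k \<Longrightarrow> w r i = a"
proof -
  obtain w :: "nat \<times> nat \<Rightarrow> nat \<Rightarrow> 'a" where w: "OA k A ({..<n} \<times> {..<n}) w"
    using has_OA_E[OF assms(1-3)] .
  have "n > 0" using assms by (auto simp: card_gt_0_iff)
  then have r: "(0, 0) \<in> {..<n} \<times> {..<n}" by simp
  have "\<exists>g. bij_betw g A A \<and> g (w (0, 0) i) = a" if "i < k" for i
    using bij_with_value[OF assms(2,2) refl OA_mem[OF w r that] assms(4)] by metis
  then obtain g where g: "\<And>i. i < k \<Longrightarrow> bij_betw (g i) A A \<and> g i (w (0, 0) i) = a"
    by metis
  show ?thesis
    by (rule that[OF OA_relabel[OF w, of g] r]) (use g in auto)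
qed

lemma OA_pair_count:
  assumes "OA k A R w" "finite A" "i < k" "j < k" "i \<noteq> j" "P \<subseteq> A" "Q \<subseteq> A"
  shows "card {r \<in> R. w r i \<in> P \<and> w r j \<in> Q} = card P * card Q"
proof -
  let ?f = "\<lambda>r. (w r i, w r j)" and ?S = "{r \<in> R. w r i \<in> P \<and> w r j \<in> Q}"
  have bij: "bij_betw ?f R (A \<times> A)" using assms by (simp add: OA_def)
  have "?f ` ?S = P \<times> Q"
  proof
    show "P \<times> Q \<subseteq> ?f ` ?S"
    proof
      fix z assume "z \<in> P \<times> Q"
      moreover from this have "z \<in> ?f ` R" using bij assms(6,7) unfolding bij_betw_def by blast
      ultimately show "z \<in> ?f ` ?S" by auto
    qed
  qed auto
  moreover have "inj_on ?f ?S"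
    using bij unfolding bij_betw_def by (auto intro: inj_on_subset)
  ultimately have "card ?S = card (P \<times> Q)" using card_image[of ?f ?S] by simp
  then show ?thesis by (simp add: card_cartesian_product)
qed

lemma OA_count:
  assumes "OA k A R w" "finite A" "2 \<le> k" "i < k" "P \<subseteq> A"
  shows "card {r \<in> R. w r i \<in> P} = card P * card A"
proof -
  obtain j where j: "j < k" "i \<noteq> j"
  proof (cases "i = 0")
    case True then show ?thesis using that[of 1] assms(3) by simp
  next
    case False then show ?thesis using that[of 0] assms(3) by simp
  qed
  have "{r \<in> R. w r i \<in> P} = {r \<in> R. w r i \<in> P \<and> w r j \<in> A}"
    using OA_mem[OF assms(1) _ j(1)] by auto
  then show ?thesis using OA_pair_count[OF assms(1,2,4) j assms(5)] by simp
qed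

section \<open>Constructions\<close>

text \<open>The columns are the linear forms \<open>y\<close>, \<open>x\<close>, \<open>x + y\<close>, \<open>x + 2 y\<close>, \dots modulo \<open>n\<close>.\<close>

lemma has_OA_cyclic:
  assumes "n > 0" "2 \<le> k" "\<And>d. 0 < d \<Longrightarrow> d < k - 1 \<Longrightarrow> coprime d n"
  shows "has_OA k n"
proof -
  define w :: "int \<times> int \<Rightarrow> nat \<Rightarrow> int" where
    "w = (\<lambda>(x, y) i. if i = 0 then y else (x + int (i - 1) * y) mod int n)"
  let ?A = "{0..<int n}"
  have cong_eq: "a = b" if "a \<in> ?A" "b \<in> ?A" "int n dvd a - b" for a b
    using that by (metis atLeastLessThan_iff mod_eq_dvd_iff mod_pos_pos_trivial)
  have "packing k ?A (?A \<times> ?A) w"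
  proof (rule packingI)
    show "w r i \<in> ?A" if "r \<in> ?A \<times> ?A" "i < k" for r i
      using that assms(1) by (auto simp: w_def)
    fix i j r r'
    assume ij: "i < j" "j < k" and r: "r \<in> ?A \<times> ?A" "r' \<in> ?A \<times> ?A"
      and eq: "w r i = w r' i" "w r j = w r' j"
    obtain x y where xy: "r = (x, y)" by force
    obtain x' y' where xy': "r' = (x', y')" by force
    have j: "int n dvd (x + int (j - 1) * y) - (x' + int (j - 1) * y')"
      using eq(2) ij(1) by (simp add: w_def xy xy' mod_eq_dvd_iff)
    have y: "y = y'"
    proof (cases "i = 0")
      case True
      then show ?thesis using eq(1) by (simp add: w_def xy xy')
    next
      case False
      have i: "int n dvd (x + int (i - 1) * y) - (x' + int (i - 1) * y')"
        using eq(1) False by (simp add: w_def xy xy' mod_eq_dvd_iff)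
      \<comment> \<open>Subtraction eliminates \<open>x\<close>. As \<open>i\<close> is positive,
        \<open>j - i\<close> lies strictly between 0 and \<open>k - 1\<close>, hence is a unit
        modulo \<open>n\<close>.\<close>
      have "(x + int (j - 1) * y) - (x' + int (j - 1) * y') -
          ((x + int (i - 1) * y) - (x' + int (i - 1) * y')) =
          (int (j - 1) - int (i - 1)) * (y - y')" by (simp add: algebra_simps)
      also have "int (j - 1) - int (i - 1) = int (j - i)" using False ij by linarith
      finally have "int n dvd int (j - i) * (y - y')" using dvd_diff[OF j i] by simp
      moreover have "coprime (int n) (int (j - i))"
        unfolding coprime_int_iff by (rule coprime_imp_coprime[OF assms(3)[of "j - i"]])
          (use ij False in auto)
      ultimately have "int n dvd y - y'" by (simp add: coprime_dvd_mult_right_iff)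
      then show ?thesis using cong_eq r by (simp add: xy xy')
    qed
    then have "int n dvd x - x'" using j by simp
    then show "r = r'" using cong_eq r y by (simp add: xy xy')
  qed
  then show ?thesis
    by (rule has_OA_packing[where n = n]) (use assms(2) in \<open>auto simp: card_cartesian_product power2_eq_square\<close>)
qed

lemma has_OA_odd:
  assumes "odd n"
  shows "has_OA 4 n"
proof (rule has_OA_cyclic)
  show "n > 0" using assms by (rule odd_pos)
  fix d :: nat assume "0 < d" "d < 4 - 1"
  then have "d = 1 \<or> d = 2" by auto
  then show "coprime d n" using assms by (auto simp: coprime_left_2_iff_odd)
qed simp

lemma has_OA_product:
  assumes "has_OA k m" "has_OA k n" "2 \<le> k"
  shows "has_OA k (m * n)"
proof -
  obtain v :: "nat \<times> nat \<Rightarrow> nat \<Rightarrow> nat" where v: "OA k {..<m} ({..<m} \<times> {..<m}) v"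
    using assms(1) by (auto simp: has_OA_def)
  obtain w :: "nat \<times> nat \<Rightarrow> nat \<Rightarrow> nat" where w: "OA k {..<n} ({..<n} \<times> {..<n}) w"
    using assms(2) by (auto simp: has_OA_def)
  note pv = OA_imp_packing[OF v] and pw = OA_imp_packing[OF w]
  have "packing k ({..<m} \<times> {..<n}) (({..<m} \<times> {..<m}) \<times> ({..<n} \<times> {..<n}))
      (\<lambda>(r, s) i. (v r i, w s i))"
  proof (rule packingI, goal_cases)
    case (1 r i)
    then show ?case using packing_mem[OF pv] packing_mem[OF pw] by (cases r) auto
  next
    case (2 i j r r')
    obtain a b where r: "r = (a, b)" by (rule prod.exhaust)
    obtain a' b' where r': "r' = (a', b')" by (rule prod.exhaust)
    have "i < k" "i \<noteq> j" using 2 by auto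
    then have "a = a'" "b = b'"
      using 2 packing_eq[OF pv, of i j a a'] packing_eq[OF pw, of i j b b']
      by (auto simp: r r')
    then show ?case by (simp add: r r')
  qed
  then show ?thesis
    by (rule has_OA_packing) (use assms(3) in \<open>auto simp: power2_eq_square algebra_simps\<close>)
qed

text \<open>
  Wilson's construction: the last column of the array with \<open>k + 1\<close> columns is truncated to the
  symbols below \<open>u\<close>. A row with a surviving last symbol is inflated by the array of order
  \<open>m + 1\<close> with one constant row (the row \<open>None\<close>) removed, the other rows by the array of order \<open>m\<close>;
  the array of order \<open>u\<close> covers the pairs of surviving symbols.
\<close>

lemma has_OA_wilson:
  assumes k: "2 \<le> k" and m: "has_OA k m" and m1: "has_OA k (m + 1)"
    and t: "has_OA (k + 1) t" and u: "has_OA k u" and ut: "u \<le> t"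
  shows "has_OA k (m * t + u)"
proof -
  let ?M = "Some ` {..<m}" and ?M1 = "insert None (Some ` {..<m})"
  have cM: "card ?M = m" by (simp add: card_image)
  have cM1: "card ?M1 = m + 1" by (simp add: card_image)
  define R0 where "R0 = {..<m} \<times> {..<m}"
  define R1 where "R1 = {..<m+1} \<times> {..<m+1}"
  define Rt where "Rt = {..<t} \<times> {..<t}"
  define Ru where "Ru = {..<u} \<times> {..<u}"
  obtain v0 :: "nat \<times> nat \<Rightarrow> nat \<Rightarrow> nat option" where v0: "OA k ?M R0 v0"
    using has_OA_E[OF m _ cM] R0_def by auto
  obtain v1 :: "nat \<times> nat \<Rightarrow> nat \<Rightarrow> nat option" and r0 where v1: "OA k ?M1 R1 v1"
    and r0: "r0 \<in> R1" "\<And>i. i < k \<Longrightarrow> v1 r0 i = None"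
    using has_OA_pointed[OF m1 _ cM1, of None] R1_def by auto
  obtain b :: "nat \<times> nat \<Rightarrow> nat \<Rightarrow> nat" where b: "OA (k + 1) {..<t} Rt b"
    using t by (auto simp: has_OA_def Rt_def)
  obtain c :: "nat \<times> nat \<Rightarrow> nat \<Rightarrow> nat" where c: "OA k {..<u} Ru c"
    using u by (auto simp: has_OA_def Ru_def)
  note p0 = OA_imp_packing[OF v0] and p1 = OA_imp_packing[OF v1]
    and pt = OA_imp_packing[OF b] and pu = OA_imp_packing[OF c]
  define V where "V r = (if b r k < u then v1 else v0)" for r
  define S where "S r = (if b r k < u then R1 - {r0} else R0)" for r
  \<comment> \<open>\<open>Inl (a, p)\<close> is copy \<open>p\<close> of the base symbol
    \<open>a\<close>; the symbols \<open>Inr\<close> are the surviving symbols of the truncated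
    column.\<close>
  define A where "A = Inl ` ({..<t} \<times> {..<m}) \<union> (Inr ` {..<u} :: (nat \<times> nat + nat) set)"
  define R where "R = Inl ` Sigma Rt S \<union> Inr ` Ru"
  define w where "w r i = (case r of
      Inl (x, s) \<Rightarrow> (case V x s i of Some p \<Rightarrow> Inl (b x i, p) | None \<Rightarrow> Inr (b x k))
    | Inr y \<Rightarrow> Inr (c y i))" for r and i :: nat
  have V_mem: "V x s i \<in> ?M1" "V x s i = None \<Longrightarrow> b x k < u"
    if "x \<in> Rt" "s \<in> S x" "i < k" for x s i
    using that packing_mem[OF p0, of s i] packing_mem[OF p1, of s i]
    by (auto simp: V_def S_def split: if_splits)
  have V_eq: "s = s'" if "x \<in> Rt" "s \<in> S x" "s' \<in> S x" "i < k" "j < k" "i \<noteq> j"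
    "V x s i = V x s' i" "V x s j = V x s' j" for x s s' i j
    using that packing_eq[OF p0, of i j s s'] packing_eq[OF p1, of i j s s']
    by (auto simp: V_def S_def split: if_splits)
  \<comment> \<open>Two entries \<open>None\<close> would be two agreements with the constant row
    \<open>r0\<close>, which \<open>S\<close> removes. Pairs of symbols \<open>Inr\<close> are thus
    left to \<open>c\<close>.\<close>
  have V_None: False if "x \<in> Rt" "s \<in> S x" "i < k" "j < k" "i \<noteq> j"
    "V x s i = None" "V x s j = None" for x s i j
  proof -
    have "b x k < u" using that V_mem(2) by blast
    then have "s \<in> R1" "s \<noteq> r0" "v1 s i = v1 r0 i" "v1 s j = v1 r0 j"
      using that r0 by (simp_all add: V_def S_def)
    then show False using packing_eq[OF p1 that(3-5)] r0(1) by blast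
  qed
  have "packing k A R w"
  proof (rule packingI)
    fix r i assume r: "r \<in> R" and i: "i < k"
    show "w r i \<in> A"
    proof (cases r)
      case (Inl z)
      obtain x s where xs: "z = (x, s)" by (cases z)
      have mem: "x \<in> Rt" "s \<in> S x" using r by (auto simp: R_def Inl xs)
      have "b x i \<in> {..<t}" using packing_mem[OF pt mem(1)] i by simp
      then show ?thesis
        using V_mem[OF mem i] by (cases "V x s i") (auto simp: w_def A_def Inl xs)
    next
      case (Inr y)
      then show ?thesis
        using r packing_mem[OF pu, of y i] i by (auto simp: R_def w_def A_def)
    qed
  next
    fix i j r r'
    assume ij: "i < j" "j < k" and r: "r \<in> R" "r' \<in> R"
      and eq: "w r i = w r' i" "w r j = w r' j"
    have ij': "i < k" "j < k" "i \<noteq> j" using ij by auto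
    have mixed: False if "Inl z \<in> R" "w (Inl z) i = w (Inr y) i" "w (Inl z) j = w (Inr y) j" for z y
      using that V_None[of "fst z" "snd z" i j] ij'
      by (cases z; cases "V (fst z) (snd z) i"; cases "V (fst z) (snd z) j")
        (auto simp: w_def R_def)
    show "r = r'"
    proof (cases r; cases r')
      fix z z' assume z: "r = Inl z" "r' = Inl z'"
      obtain x s where xs: "z = (x, s)" by (cases z)
      obtain x' s' where xs': "z' = (x', s')" by (cases z')
      have mem: "x \<in> Rt" "s \<in> S x" "x' \<in> Rt" "s' \<in> S x'"
        using r by (auto simp: R_def z xs xs')
      \<comment> \<open>In column \<open>i\<close> the rows \<open>x\<close> and \<open>x'\<close>
        of \<open>b\<close> agree, or in the last column if the entry is \<open>None\<close>;
        likewise for \<open>j\<close>. As \<open>None\<close> occurs at most once, two different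
        columns of \<open>b\<close> agree.\<close>
      have "x = x' \<and> V x s i = V x' s' i \<and> V x s j = V x' s' j"
      proof -
        have i: "V x s i = V x' s' i \<and> (if V x s i = None then b x k = b x' k else b x i = b x' i)"
          using eq(1) by (cases "V x s i"; cases "V x' s' i") (simp_all add: w_def z xs xs')
        have j: "V x s j = V x' s' j \<and> (if V x s j = None then b x k = b x' k else b x j = b x' j)"
          using eq(2) by (cases "V x s j"; cases "V x' s' j") (simp_all add: w_def z xs xs')
        have x: "x = x'" if "l < k + 1" "l' < k + 1" "l \<noteq> l'" "b x l = b x' l" "b x l' = b x' l'" for l l'
          by (rule packing_eq[OF pt that(1-3) mem(1,3) that(4,5)])
        show ?thesis
          using i j x[of i j] x[of i k] x[of k j] V_None[OF mem(1,2) ij'] ij'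
          by (simp split: if_splits)
      qed
      then show ?thesis using V_eq[OF mem(1,2) _ ij', of s'] mem(4) by (auto simp: z xs xs')
    next
      fix y y' assume y: "r = Inr y" "r' = Inr y'"
      have "y \<in> Ru" "y' \<in> Ru" using r by (auto simp: R_def y)
      moreover have "c y i = c y' i" "c y j = c y' j" using eq by (simp_all add: w_def y)
      ultimately show ?thesis using packing_eq[OF pu ij'] y by blast
    next
      fix z y assume "r = Inl z" "r' = Inr y"
      then show ?thesis using mixed[of z y] r eq by simp
    next
      fix y z assume "r = Inr y" "r' = Inl z"
      then show ?thesis using mixed[of z y] r eq by simp
    qed
  qed
  moreover have "finite A" by (simp add: A_def)
  moreover have "card A = m * t + u"
    unfolding A_def by (subst card_Un_disjoint) (auto simp: card_image card_cartesian_product)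
  \<comment> \<open>Each of the \<open>u * t\<close> rows with surviving last symbol is inflated to
    \<open>(m + 1)^2 - 1\<close> rows, every other one to \<open>m^2\<close>, and \<open>c\<close>
    adds \<open>u^2\<close>.\<close>
  moreover have "card R = (m * t + u)\<^sup>2"
  proof -
    have fin: "finite Rt" "finite R0" "finite R1" "finite Ru"
      by (simp_all add: Rt_def R0_def R1_def Ru_def)
    let ?X = "{x \<in> Rt. b x k \<in> {..<u}}" and ?Y = "{x \<in> Rt. b x k \<notin> {..<u}}"
    have X: "card ?X = u * t"
      using OA_count[OF b, of k "{..<u}"] k ut by simp
    have "card ?X + card ?Y = card (?X \<union> ?Y)"
      using fin(1) by (intro card_Un_disjoint[symmetric]) auto
    also have "?X \<union> ?Y = Rt" by auto
    finally have XY: "card ?X + card ?Y = t * t" by (simp add: Rt_def)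
    have "card (Sigma Rt S) = (\<Sum>x\<in>Rt. card (S x))"
      using fin by (subst card_SigmaI) (auto simp: S_def)
    also have "\<dots> = (\<Sum>x\<in>?X. card (S x)) + (\<Sum>x\<in>?Y. card (S x))"
      using fin(1) by (subst sum.union_disjoint[symmetric]) (auto intro!: sum.cong)
    also have "(\<Sum>x\<in>?X. card (S x)) = (\<Sum>x\<in>?X. m * m + 2 * m)"
      using r0(1) by (intro sum.cong) (auto simp: S_def R1_def algebra_simps)
    also have "(\<Sum>x\<in>?Y. card (S x)) = (\<Sum>x\<in>?Y. m * m)"
      by (intro sum.cong) (auto simp: S_def R0_def)
    finally have "card (Sigma Rt S) = card ?X * (m * m + 2 * m) + card ?Y * (m * m)"
      by simp
    also have "\<dots> = (card ?X + card ?Y) * (m * m) + card ?X * (2 * m)"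
      by (simp add: algebra_simps)
    also have "\<dots> = t * t * (m * m) + u * t * (2 * m)"
      unfolding XY unfolding X ..
    finally have Sig: "card (Sigma Rt S) = t * t * (m * m) + u * t * (2 * m)" .
    have "finite (Sigma Rt S)"
      using fin by (intro finite_SigmaI) (simp_all add: S_def)
    moreover have "Inl ` Sigma Rt S \<inter> Inr ` Ru = {}" by blast
    ultimately have "card R = card (Inl ` Sigma Rt S :: (_ + nat \<times> nat) set) + card (Inr ` Ru :: (((nat \<times> nat) \<times> nat \<times> nat) + _) set)"
      unfolding R_def using fin by (intro card_Un_disjoint) simp_all
    also have "\<dots> = card (Sigma Rt S) + u * u"
      by (simp add: card_image Ru_def)
    finally show ?thesis by (simp add: Sig power2_eq_square algebra_simps)
  qed
  ultimately show ?thesis using k by (intro has_OA_packing)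
qed

section \<open>Explicit arrays by cyclic development\<close>

text \<open>Symbols from \<open>m\<close> on are the infinite points of difference methods:
  translation fixes them.\<close>

definition develop :: "int \<Rightarrow> int list list \<Rightarrow> int list list" where
  "develop m rs = concat (map (\<lambda>g. map (map (\<lambda>x. if x < m then (x + g) mod m else x)) rs) [0..m - 1])"

definition separated :: "int \<Rightarrow> int list list \<Rightarrow> bool" where
  "separated n rs \<longleftrightarrow> list_all (\<lambda>r. length r = 4 \<and> list_all (\<lambda>x. 0 \<le> x \<and> x < n) r) rs \<and>
     list_all (\<lambda>(i, j). distinct (map (\<lambda>r. (r ! i, r ! j)) rs))
       [(0, 1), (0, 2), (0, 3), (1, 2), (1, 3), (2, 3)]"

lemma separated_packing:
  assumes "separated n rs"
  shows "packing 4 {0..<n} {..<length rs} (\<lambda>r i. rs ! r ! i)"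
proof (rule packingI)
  fix r i :: nat assume "r \<in> {..<length rs}" "i < 4"
  then have "length (rs ! r) = 4" "\<forall>x\<in>set (rs ! r). 0 \<le> x \<and> x < n"
    using assms by (auto simp: separated_def list_all_iff)
  then show "rs ! r ! i \<in> {0..<n}" using \<open>i < 4\<close> by simp
next
  fix i j r r' :: nat
  assume ij: "i < j" "j < 4" and r: "r \<in> {..<length rs}" "r' \<in> {..<length rs}"
    and eq: "rs ! r ! i = rs ! r' ! i" "rs ! r ! j = rs ! r' ! j"
  have "(i, j) \<in> set [(0, 1), (0, 2), (0, 3), (1, 2), (1, 3), (2, 3)]"
    using ij by (auto simp: numeral_eq_Suc less_Suc_eq)
  then have "distinct (map (\<lambda>r. (r ! i, r ! j)) rs)"
    using assms unfolding separated_def list_all_iff by fast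
  then show "r = r'"
    using r eq by (auto simp: distinct_conv_nth)
qed

text \<open>34 = 2 + 4 * 8: two constant words and eight orbits of translation modulo 4, with
  infinite points 4 and 5. In every two columns just the pairs (4, 5) and (5, 4) stay
  uncovered.\<close>

definition code6 :: "int list list" where
  "code6 = [4, 4, 4, 4] # [5, 5, 5, 5] # develop 4
     [[4, 0, 0, 0], [5, 0, 1, 2], [0, 4, 0, 2], [0, 5, 2, 1], [0, 0, 4, 3], [0, 3, 5, 0],
      [0, 1, 3, 4], [0, 2, 1, 5]]"

lemma packing_6_34:
  "\<exists>w :: nat \<Rightarrow> nat \<Rightarrow> int. packing 4 {0..<6} {..<34} w"
proof -
  have "separated 6 code6" "length code6 = 34" by code_simp+
  then show ?thesis using separated_packing by metis
qed

lemma separated_has_OA: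
  assumes "separated n rs" "int (length rs) = n * n" "0 \<le> n"
  shows "has_OA 4 (nat n)"
proof (rule has_OA_packing[OF separated_packing[OF assms(1)]])
  have "nat (int (length rs)) = nat n * nat n"
    using assms(2,3) by (simp add: nat_mult_distrib)
  then show "card {..<length rs} = (nat n)\<^sup>2" by (simp add: power2_eq_square)
qed auto

text \<open>
  In arrays of order \<open>m + 3\<close> the symbols below \<open>m\<close> are the integers modulo \<open>m\<close>, the other three are
  fixed by the development and carry an array of order 3 of their own.
\<close>

definition affine3 :: "int \<Rightarrow> int list list" where
  "affine3 m = map (map (\<lambda>x. m + x))
     [[0, 0, 0, 0], [0, 1, 1, 2], [0, 2, 2, 1], [1, 0, 1, 1], [1, 1, 2, 0], [1, 2, 0, 2],
      [2, 0, 2, 2], [2, 1, 0, 1], [2, 2, 1, 0]]"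

text \<open>In orders 10 and 14 the set of base rows is invariant under cyclic shifts of the
  columns, so one listed row stands for four.\<close>

definition rotated :: "int list list \<Rightarrow> int list list" where
  "rotated rs = concat (map (\<lambda>r. map (\<lambda>i. rotate i r) [0..<4]) rs)"

text \<open>
  For \<open>q = 4, 8\<close> the rows are \<open>(x, y, x + y, x + \<alpha> y)\<close> over the field with \<open>q\<close> elements, where
  \<open>\<alpha>\<^sup>i\<close> is written as \<open>i\<close> and \<open>0\<close> as \<open>q - 1\<close>, so that multiplication by \<open>\<alpha>\<close> develops the rows.
\<close>

lemma has_OA_4: "has_OA 4 4"
proof -
  let ?rs = "[3, 3, 3, 3] # develop 3
    [[0, 3, 0, 0], [3, 0, 0, 1], [0, 0, 3, 2], [0, 1, 2, 1], [0, 2, 1, 3]]"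
  have "separated 4 ?rs" "int (length ?rs) = 4 * 4" by code_simp+
  then show ?thesis using separated_has_OA by fastforce
qed

lemma has_OA_8: "has_OA 4 8"
proof -
  let ?rs = "[7, 7, 7, 7] # develop 7
    [[0, 7, 0, 0], [7, 0, 0, 1], [0, 0, 7, 3], [0, 1, 3, 6], [0, 3, 1, 5], [0, 2, 6, 1],
     [0, 6, 2, 7], [0, 4, 5, 4], [0, 5, 4, 2]]"
  have "separated 8 ?rs" "int (length ?rs) = 8 * 8" by code_simp+
  then show ?thesis using separated_has_OA by fastforce
qed

lemma has_OA_10: "has_OA 4 10"
proof -
  \<comment> \<open>The finite parts (0, 1, 4), (0, 2, 1), (0, 4, 2) arise from each other by
    multiplication by 2 modulo 7. The row count is 9 + 7 * (1 + 4 * 3) = 100.\<close>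
  let ?rs = "affine3 7 @ develop 7
    ([0, 0, 0, 0] # rotated [[7, 0, 1, 4], [8, 0, 2, 1], [9, 0, 4, 2]])"
  have "separated 10 ?rs" "int (length ?rs) = 10 * 10" by code_simp+
  then show ?thesis using separated_has_OA by fastforce
qed

lemma has_OA_14: "has_OA 4 14"
proof -
  let ?rs = "affine3 11 @ develop 11 ([0, 0, 0, 0] #
    rotated [[11, 0, 4, 1], [12, 0, 6, 2], [13, 0, 9, 8], [0, 1, 4, 6]])"
  have "separated 14 ?rs" "int (length ?rs) = 14 * 14" by code_simp+
  then show ?thesis using separated_has_OA by fastforce
qed

section \<open>Existence for all even orders other than 2 and 6\<close>

text \<open>Wilson's construction with \<open>m = 3\<close>, which needs orders 3 and 4. Coprimality
  to 6 makes 1, 2, 3 units modulo \<open>t\<close>, as the fifth column of the cyclic array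
  requires.\<close>

lemma has_OA_3t_plus:
  assumes "coprime t 6" "odd u" "u \<le> t" "n = 3 * t + u"
  shows "has_OA 4 n"
proof -
  have "coprime t 2" "coprime t 3" using assms(1) coprime_mult_right_iff[of t 2 3] by simp_all
  then have co: "coprime 2 t" "coprime 3 t" by (simp_all add: coprime_commute)
  have "has_OA (4 + 1) t"
  proof (rule has_OA_cyclic)
    show "t > 0" using assms by (cases t) auto
    fix d :: nat assume "0 < d" "d < 4 + 1 - 1"
    then have "d = 1 \<or> d = 2 \<or> d = 3" by auto
    then show "coprime d t" using co by auto
  qed simp
  then show ?thesis
    using has_OA_wilson[of 4 3 t u] has_OA_odd[of 3] has_OA_odd[of u] has_OA_4 assms by simp
qed

lemma has_OA_58:
  assumes "even n" "58 \<le> n"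
  shows "has_OA 4 n"
proof -
  \<comment> \<open>With \<open>t = 6 * j + 1\<close> the remainder \<open>u\<close> is
    \<open>1 + (n - 4) mod 18\<close>. Being odd it is at most 17, which is below \<open>t\<close>
    once \<open>j >= 3\<close>; this is where 58 comes from.\<close>
  define j where "j = (n - 4) div 18"
  define u where "u = n - 3 * (6 * j + 1)"
  have n: "n = 18 * j + 4 + (n - 4) mod 18" and "(n - 4) mod 18 < 18"
    using assms(2) by (simp_all add: j_def)
  moreover have "j \<ge> 3" using assms(2) unfolding j_def by linarith
  ultimately have u: "u \<le> 18" "n = 3 * (6 * j + 1) + u"
    by (simp_all add: u_def)
  moreover have "odd u" using assms(1) u(2) by simp
  then have "u \<noteq> 18" by auto
  then have "u \<le> 17" using u(1) by linarith
  moreover have "coprime (6 * j + 1) 6"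
  proof (rule coprimeI)
    fix d assume "d dvd 6 * j + 1" "d dvd 6"
    then show "is_unit d" using dvd_add_right_iff[of d "6 * j" 1] dvd_mult2 by blast
  qed
  ultimately show ?thesis
    using u(2) \<open>odd u\<close> \<open>j \<ge> 3\<close> by (intro has_OA_3t_plus[of "6 * j + 1" u]) auto
qed

lemma has_OA_below_58:
  assumes "even n" "n < 58" "n \<noteq> 0" "n \<noteq> 2" "n \<noteq> 6"
  shows "has_OA 4 n"
proof -
  note odd = has_OA_odd
  have mult: "has_OA 4 (a * b)" if "has_OA 4 a" "has_OA 4 b" for a b
    using that by (rule has_OA_product) simp
  have co: "coprime 5 (6 :: nat)" "coprime 7 (6 :: nat)" "coprime 11 (6 :: nat)" "coprime 13 (6 :: nat)"
    by (simp_all add: coprime_iff_gcd_eq_1 gcd_non_0_nat)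
  obtain m where m: "n = 2 * m" using assms(1) by (rule evenE)
  \<comment> \<open>The orders \<open>2 * m\<close> in turn: explicit arrays; larger multiples of 4,
    as products; orders \<open>3 * t + u\<close>; and 30, 42, 54 as multiples by 3 of 10, 14,
    18.\<close>
  have "m \<in> {2,4,5,7} \<union> {6,8,10,12,14,16,18,20,22,24,26,28} \<union> {9,11,13,17,19,23,25} \<union> {15,21,27}"
    using assms m unfolding Un_iff insert_iff empty_iff by presburger
  then show ?thesis
  proof (elim UnE)
    assume "m \<in> {2,4,5,7}"
    then show ?thesis using has_OA_4 has_OA_8 has_OA_10 has_OA_14 m by auto
  next
    assume "m \<in> {6,8,10,12,14,16,18,20,22,24,26,28}"
    then show ?thesis
      using m mult[OF has_OA_4 has_OA_4] mult[OF has_OA_4 has_OA_8]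
        mult[OF has_OA_4 odd, of 3] mult[OF has_OA_4 odd, of 5] mult[OF has_OA_4 odd, of 7]
        mult[OF has_OA_4 odd, of 9] mult[OF has_OA_4 odd, of 11] mult[OF has_OA_4 odd, of 13]
        mult[OF has_OA_8 odd, of 3] mult[OF has_OA_8 odd, of 5] mult[OF has_OA_8 odd, of 7]
        mult[OF has_OA_4 mult[OF has_OA_4 odd], of 3]
      by auto
  next
    assume "m \<in> {9,11,13,17,19,23,25}"
    then show ?thesis
      using m has_OA_3t_plus[of 5 3] has_OA_3t_plus[of 7 1] has_OA_3t_plus[of 7 5]
        has_OA_3t_plus[of 11 1] has_OA_3t_plus[of 11 5] has_OA_3t_plus[of 13 7]
        has_OA_3t_plus[of 13 11] co
      by auto
  next
    have 18: "has_OA 4 18" by (rule has_OA_3t_plus[of 5 3]) (use co in auto)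
    assume "m \<in> {15,21,27}"
    then show ?thesis
      using m mult[OF odd has_OA_10, of 3] mult[OF odd has_OA_14, of 3] mult[OF odd 18, of 3]
      by auto
  qed
qed

theorem has_OA_exists:
  assumes "2 < n" "n \<noteq> 6"
  shows "has_OA 4 n"
proof (cases "even n")
  case True
  then show ?thesis using has_OA_58 has_OA_below_58 assms by (cases "n < 58") auto
qed (rule has_OA_odd)

text \<open>The binary repetition code: its two words differ in every position.\<close>

lemma packing_2_2: "packing k {0..<2} {..<2} (\<lambda>r (i :: nat). r :: nat)"
  by (auto intro!: packingI)

text \<open>Three binary words: each position identifies two of them, and there are only three pairs.\<close>

lemma packing_2_le:
  assumes "packing 4 A R w" "card A = 2"
  shows "card R \<le> 2"
proof (rule ccontr)
  assume "\<not> card R \<le> 2"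
  then obtain T where T: "T \<subseteq> R" "card T = 3" using obtain_subset_with_card_n[of 3 R] by auto
  then obtain r s t where rst: "r \<in> R" "s \<in> R" "t \<in> R" "r \<noteq> s" "r \<noteq> t" "s \<noteq> t"
    by (auto simp: card_3_iff)
  define I where "I x y = {i. i < 4 \<and> w x i = w y i}" for x y
  have le: "card (I x y) \<le> 1" if "x \<in> R" "y \<in> R" "x \<noteq> y" for x y
  proof -
    have "i = j" if "i \<in> I x y" "j \<in> I x y" for i j
      using packing_eq[OF assms(1), of i j x y] that \<open>x \<in> R\<close> \<open>y \<in> R\<close> \<open>x \<noteq> y\<close>
      unfolding I_def by blast
    moreover have "finite (I x y)" by (simp add: I_def)
    ultimately show ?thesis by (simp add: card_le_Suc0_iff_eq)
  qed
  have "{..<4} \<subseteq> I r s \<union> I r t \<union> I s t"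
  proof
    fix i :: nat assume "i \<in> {..<4}"
    then show "i \<in> I r s \<union> I r t \<union> I s t"
      using packing_mem[OF assms(1), of _ i] rst(1-3) assms(2) by (auto simp: I_def card_2_iff)
  qed
  then have "4 \<le> card (I r s \<union> I r t \<union> I s t)"
    using card_mono[of "I r s \<union> I r t \<union> I s t" "{..<4}"] by (simp add: I_def)
  also have "\<dots> \<le> card (I r s) + card (I r t) + card (I s t)"
    by (meson card_Un_le add_le_mono1 le_trans)
  finally show False using le[OF rst(1,2,4)] le[OF rst(1,3,5)] le[OF rst(2,3,6)] by linarith
qed

section \<open>Tarry's theorem\<close>

text \<open>\<open>K\<close> acts as the kernel of \<open>h\<close>: adding a fixed member of a
  fibre maps this fibre injectively into \<open>K\<close>.\<close>

lemma fibre_card_le: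
  assumes "finite G" "finite K"
    and diff: "\<And>Y Z. \<lbrakk>Y \<in> G; Z \<in> G; h Y = h Z\<rbrakk> \<Longrightarrow> sym_diff Y Z \<in> K"
  shows "card {Z \<in> G. h Z = c} \<le> card K" "card G \<le> card (h ` G) * card K"
proof -
  show fibre: "card {Z \<in> G. h Z = c} \<le> card K" for c
  proof (cases "{Z \<in> G. h Z = c} = {}")
    case True
    then show ?thesis by (simp only: card.empty)
  next
    case False
    then obtain Y where Y: "Y \<in> G" "h Y = c" by blast
    have "inj_on (sym_diff Y) {Z \<in> G. h Z = c}" by (rule inj_onI) blast
    moreover have "sym_diff Y ` {Z \<in> G. h Z = c} \<subseteq> K" using diff Y by auto
    ultimately show ?thesis using card_inj_on_le assms(2) by blast
  qed
  have "G = (\<Union>c \<in> h ` G. {Z \<in> G. h Z = c})" by auto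
  then have "card G \<le> (\<Sum>c \<in> h ` G. card {Z \<in> G. h Z = c})"
    using card_UN_le[of "h ` G" "\<lambda>c. {Z \<in> G. h Z = c}"] assms(1) by simp
  also have "\<dots> \<le> card (h ` G) * card K"
    using sum_bounded_above[of "h ` G" "\<lambda>c. card {Z \<in> G. h Z = c}" "card K"] fibre by simp
  finally show "card G \<le> card (h ` G) * card K" .
qed

text \<open>A \<open>\<plusminus>1\<close>-valued character of a finite group sums to 0 or to the order of the group.\<close>

lemma character_sum_nonneg:
  fixes \<chi> :: "'b set \<Rightarrow> int"
  assumes closed: "\<And>Y Z. Y \<in> E \<Longrightarrow> Z \<in> E \<Longrightarrow> sym_diff Y Z \<in> E"
    and mult: "\<And>Y Z. Y \<in> E \<Longrightarrow> Z \<in> E \<Longrightarrow> \<chi> (sym_diff Y Z) = \<chi> Y * \<chi> Z"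
    and sign: "\<And>Y. Y \<in> E \<Longrightarrow> \<chi> Y \<in> {1, -1}"
  shows "0 \<le> (\<Sum>Y\<in>E. \<chi> Y)"
proof (cases "\<forall>Y\<in>E. \<chi> Y = 1")
  case True
  then show ?thesis by simp
next
  case False
  then obtain Y0 where Y0: "Y0 \<in> E" "\<chi> Y0 = -1" using sign by blast
  have "(\<Sum>Y\<in>E. \<chi> Y) = (\<Sum>Y\<in>E. - \<chi> Y)"
    by (rule sum.reindex_bij_witness[of E "sym_diff Y0" "sym_diff Y0"])
      (use closed[OF Y0(1)] mult[OF Y0(1)] Y0(2) in \<open>auto\<close>)
  then show ?thesis by (simp add: sum_negf)
qed

text \<open>
  If a relation has \<open>a\<close>, \<open>b\<close>, \<open>c\<close>, \<open>d\<close> points in the four columns and \<open>b\<^sub>n\<close> rows meet it in \<open>n\<close> points, then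
  \<open>e - 3 s = 4 b\<^sub>4\<close>. The last two conditions express that \<open>b\<^sub>4 = 0\<close> if a column is avoided and that
  \<open>b\<^sub>0 = 0\<close> if the last column is contained in the relation.
\<close>

definition feasible :: "nat \<Rightarrow> nat \<Rightarrow> nat \<Rightarrow> nat \<Rightarrow> bool" where
  "feasible a b c d \<longleftrightarrow> (let s = a + b + c + d; e = a * b + a * c + a * d + b * c + b * d + c * d in
     3 * s \<le> e \<and> (e - 3 * s) mod 4 = 0 \<and> (a = 0 \<or> b = 0 \<or> c = 0 \<or> d = 0 \<longrightarrow> e = 3 * s) \<and>
     (d = 6 \<longrightarrow> e + 144 = 15 * s))"

section \<open>Linear relations between the 24 points\<close>

locale OA_4_6 =
  fixes R :: "'r set" and w :: "'r \<Rightarrow> nat \<Rightarrow> nat"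
  assumes OA: "OA 4 {..<6} R w"
begin

lemma finite_R: "finite R" and card_R: "card R = 36"
  using OA_finite_card[OF OA] by simp_all

definition points :: "(nat \<times> nat) set" where "points = {..<4} \<times> {..<6}"

definition slice :: "(nat \<times> nat) set \<Rightarrow> nat \<Rightarrow> nat set" where
  "slice Y i = {a. (i, a) \<in> Y}"

abbreviation m :: "(nat \<times> nat) set \<Rightarrow> nat \<Rightarrow> nat" where "m Y i \<equiv> card (slice Y i)"

definition hits :: "(nat \<times> nat) set \<Rightarrow> 'r \<Rightarrow> nat" where
  "hits Y r = (\<Sum>i<4. of_bool (w r i \<in> slice Y i))"

lemma slice_subset: "Y \<subseteq> points \<Longrightarrow> slice Y i \<subseteq> {..<6}"
  by (auto simp: slice_def points_def)

lemma finite_slice: "Y \<subseteq> points \<Longrightarrow> finite (slice Y i)"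
  by (rule finite_subset[OF slice_subset]) auto

lemma finite_Pow_points: "finite (Pow points)" and card_Pow_points: "card (Pow points) = 2 ^ 24"
  by (simp_all add: points_def card_Pow)

lemma sum_hits:
  assumes "Y \<subseteq> points"
  shows "(\<Sum>r\<in>R. hits Y r) = 6 * (\<Sum>i<4. m Y i)"
proof -
  have "(\<Sum>r\<in>R. hits Y r) = (\<Sum>i<4. \<Sum>r\<in>R. of_bool (w r i \<in> slice Y i))"
    unfolding hits_def by (rule sum.swap)
  also have "\<dots> = (\<Sum>i<4. 6 * m Y i)"
  proof (rule sum.cong[OF refl])
    fix i :: nat assume "i \<in> {..<4}"
    then have "card {r \<in> R. w r i \<in> slice Y i} = m Y i * 6"
      using OA_count[OF OA _ _ _ slice_subset[OF assms]] by simp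
    then show "(\<Sum>r\<in>R. of_bool (w r i \<in> slice Y i)) = 6 * m Y i"
      using finite_R by (simp add: sum_of_bool_eq Collect_conj_eq)
  qed
  finally show ?thesis by (simp add: sum_distrib_left)
qed

text \<open>Points of different columns share exactly one row; a point of a column lies on 6 rows,
  two distinct ones share none. The parity of this inner product gives orthogonality, the case
  \<open>Y = Z\<close> the second moment of \<open>hits\<close>.\<close>

lemma sum_hits_mult:
  assumes "Y \<subseteq> points" "Z \<subseteq> points"
  shows "(\<Sum>r\<in>R. hits Y r * hits Z r) =
    (\<Sum>i<4. \<Sum>j<4. if i = j then 6 * card (slice Y i \<inter> slice Z i) else m Y i * m Z j)"
proof -
  have "(\<Sum>r\<in>R. hits Y r * hits Z r) =
      (\<Sum>r\<in>R. \<Sum>i<4. \<Sum>j<4. of_bool (w r i \<in> slice Y i) * of_bool (w r j \<in> slice Z j))"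
    unfolding hits_def sum_product ..
  also have "\<dots> = (\<Sum>i<4. \<Sum>r\<in>R. \<Sum>j<4. of_bool (w r i \<in> slice Y i) * of_bool (w r j \<in> slice Z j))"
    by (rule sum.swap)
  also have "\<dots> = (\<Sum>i<4. \<Sum>j<4. \<Sum>r\<in>R. of_bool (w r i \<in> slice Y i) * of_bool (w r j \<in> slice Z j))"
    by (intro sum.cong refl sum.swap)
  also have "\<dots> = (\<Sum>i<4. \<Sum>j<4. if i = j then 6 * card (slice Y i \<inter> slice Z i) else m Y i * m Z j)"
  proof (intro sum.cong refl)
    fix i j :: nat assume ij: "i \<in> {..<4}" "j \<in> {..<4}"
    have "(\<Sum>r\<in>R. of_bool (w r i \<in> slice Y i) * of_bool (w r j \<in> slice Z j)) =
        card {r \<in> R. w r i \<in> slice Y i \<and> w r j \<in> slice Z j}"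
      using finite_R by (simp add: sum_of_bool_eq Collect_conj_eq flip: of_bool_conj)
    also have "\<dots> = (if i = j then 6 * card (slice Y i \<inter> slice Z i) else m Y i * m Z j)"
    proof (cases "i = j")
      case True
      have "slice Y i \<inter> slice Z i \<subseteq> {..<6}" using slice_subset[OF assms(1)] by blast
      then have "card {r \<in> R. w r i \<in> slice Y i \<inter> slice Z i} = card (slice Y i \<inter> slice Z i) * 6"
        using OA_count[OF OA, of i "slice Y i \<inter> slice Z i"] ij by simp
      then show ?thesis using True by simp
    next
      case False
      then show ?thesis
        using OA_pair_count[OF OA _ _ _ False slice_subset[OF assms(1)] slice_subset[OF assms(2)]] ij
        by simp
    qed
    finally show "(\<Sum>r\<in>R. of_bool (w r i \<in> slice Y i) * of_bool (w r j \<in> slice Z j)) =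
        (if i = j then 6 * card (slice Y i \<inter> slice Z i) else m Y i * m Z j)" .
  qed
  finally show ?thesis .
qed

lemma even_hits_sym_diff: "even (hits (sym_diff Y Z) r) \<longleftrightarrow> even (hits Y r) = even (hits Z r)"
proof -
  have "hits (sym_diff Y Z) r + 2 * hits (Y \<inter> Z) r = hits Y r + hits Z r"
    unfolding hits_def sum_distrib_left sum.distrib[symmetric]
    by (intro sum.cong) (auto simp: slice_def)
  then have "even (hits (sym_diff Y Z) r + 2 * hits (Y \<inter> Z) r) = even (hits Y r + hits Z r)"
    by simp
  then show ?thesis by simp
qed

lemma even_m_sym_diff:
  assumes "Y \<subseteq> points" "Z \<subseteq> points"
  shows "even (m (sym_diff Y Z) i) \<longleftrightarrow> even (m Y i) = even (m Z i)"
proof -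
  have "slice (sym_diff Y Z) i = sym_diff (slice Y i) (slice Z i)" by (auto simp: slice_def)
  moreover have "card (sym_diff (slice Y i) (slice Z i)) = card (slice Y i - slice Z i) + card (slice Z i - slice Y i)"
    using finite_slice assms by (intro card_Un_disjoint) auto
  moreover have "m Y i = card (slice Y i \<inter> slice Z i) + card (slice Y i - slice Z i)"
    "m Z i = card (slice Z i \<inter> slice Y i) + card (slice Z i - slice Y i)"
    using finite_slice assms by (intro card_Int_Diff; blast)+
  ultimately have "m (sym_diff Y Z) i + 2 * card (slice Y i \<inter> slice Z i) = m Y i + m Z i"
    by (simp add: Int_commute)
  then have "even (m (sym_diff Y Z) i + 2 * card (slice Y i \<inter> slice Z i)) = even (m Y i + m Z i)"
    by simp
  then show ?thesis by simp
qed

text \<open>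
  The members of \<open>relations\<close> are the linear dependencies over GF(2) between the incidence vectors of
  the points. The sums of points over members of \<open>evens\<close> are orthogonal to the incidence vectors of
  all points (\<open>sign_odd_rows\<close>). The bound \<open>card_relations\<close> replaces the dimension formula by summing
  the characters \<open>sign c\<close> of the group \<open>evens\<close> over all \<open>c = odd_rows Z\<close> and over all \<open>c\<close>.
\<close>

definition relations :: "(nat \<times> nat) set set" where
  "relations = {Y. Y \<subseteq> points \<and> (\<forall>r\<in>R. even (hits Y r))}"

definition evens :: "(nat \<times> nat) set set" where
  "evens = {Y. Y \<subseteq> points \<and> (\<forall>i<4. even (m Y i))}"

lemma relations_sym_diff: "Y \<in> relations \<Longrightarrow> Z \<in> relations \<Longrightarrow> sym_diff Y Z \<in> relations"
  by (auto simp: relations_def even_hits_sym_diff)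

lemma evens_sym_diff: "Y \<in> evens \<Longrightarrow> Z \<in> evens \<Longrightarrow> sym_diff Y Z \<in> evens"
  by (auto simp: evens_def even_m_sym_diff)

lemma finite_relations: "finite relations" and finite_evens: "finite evens"
  using finite_Pow_points by (auto simp: relations_def evens_def intro: finite_subset[OF _ finite_Pow_points])

text \<open>Four parity conditions define a subgroup of index at most 16.\<close>

lemma card_evens: "2 ^ 24 \<le> 16 * card evens"
proof -
  let ?h = "\<lambda>Y. (even (m Y 0), even (m Y 1), even (m Y 2), even (m Y 3))"
  have "card (Pow points) \<le> card (?h ` Pow points) * card evens"
  proof (rule fibre_card_le(2)[OF finite_Pow_points finite_evens])
    fix Y Z assume YZ: "Y \<in> Pow points" "Z \<in> Pow points" "?h Y = ?h Z"
    have "even (m Y i) = even (m Z i)" if "i < 4" for i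
    proof -
      have "i = 0 \<or> i = 1 \<or> i = 2 \<or> i = 3" using that by auto
      then show ?thesis using YZ(3) by auto
    qed
    then show "sym_diff Y Z \<in> evens" using YZ(1,2) by (auto simp: evens_def even_m_sym_diff)
  qed
  also have "card (?h ` Pow points) \<le> card (UNIV \<times> UNIV \<times> UNIV \<times> UNIV :: (bool \<times> bool \<times> bool \<times> bool) set)"
    by (rule card_mono) simp_all
  also have "\<dots> = 16" by (simp only: card_cartesian_product card_UNIV_bool)
  finally show ?thesis unfolding card_Pow_points by simp
qed

text \<open>The exponent is, modulo 2, the inner product of the vector \<open>c\<close> with the sum
  of the points of \<open>Y\<close>.\<close>

definition sign :: "'r set \<Rightarrow> (nat \<times> nat) set \<Rightarrow> int" where
  "sign c Y = (\<Prod>r\<in>c. (-1) ^ hits Y r)"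

text \<open>The sum over GF(2) of the points of \<open>Z\<close>, as a set of rows.\<close>

definition odd_rows :: "(nat \<times> nat) set \<Rightarrow> 'r set" where
  "odd_rows Z = {r \<in> R. odd (hits Z r)}"

lemma sign_odd_rows:
  assumes "Y \<in> evens" "Z \<subseteq> points"
  shows "sign (odd_rows Z) Y = 1"
proof -
  \<comment> \<open>In \<open>sum_hits_mult\<close> the diagonal terms contain the factor 6 and the
    others an even factor \<open>m Y j\<close>.\<close>
  have "even (\<Sum>r\<in>R. hits Z r * hits Y r)"
    using assms unfolding evens_def by (subst sum_hits_mult) (auto intro!: dvd_sum)
  then have "1 = (\<Prod>r\<in>R. (-1 :: int) ^ (hits Z r * hits Y r))"
    by (simp add: power_sum[symmetric])
  also have "\<dots> = (\<Prod>r\<in>R. if odd (hits Z r) then (-1) ^ hits Y r else 1)"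
    by (intro prod.cong) (auto simp: minus_one_power_iff)
  also have "\<dots> = sign (odd_rows Z) Y"
    unfolding sign_def odd_rows_def using finite_R by (simp add: prod.inter_filter)
  finally show ?thesis by simp
qed

lemma sign_sum_nonneg: "0 \<le> (\<Sum>Y\<in>evens. sign c Y)"
proof (rule character_sum_nonneg[OF evens_sym_diff])
  show "sign c (sym_diff Y Z) = sign c Y * sign c Z" for Y Z
    unfolding sign_def prod.distrib[symmetric]
    by (intro prod.cong) (auto simp: minus_one_power_iff even_hits_sym_diff)
  show "sign c Y \<in> {1, -1}" for Y
    unfolding sign_def by (induction c rule: infinite_finite_induct) (auto simp: minus_one_power_iff)
qed

text \<open>The sum over subsets is the expansion of a product with factors 2 and 0, one for each
  row.\<close>

lemma sum_sign:
  "(\<Sum>c\<in>Pow R. sign c Y) = (if \<forall>r\<in>R. even (hits Y r) then 2 ^ 36 else 0)"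
proof -
  have "(\<Sum>c\<in>Pow R. sign c Y) = (\<Prod>r\<in>R. 1 + (-1) ^ hits Y r)"
    unfolding sign_def using prod_add[OF finite_R, of "\<lambda>r. (-1 :: int) ^ hits Y r" "\<lambda>_. 1"] by (simp add: add.commute)
  also have "\<dots> = (if \<forall>r\<in>R. even (hits Y r) then 2 ^ 36 else 0)"
    using finite_R card_R by (auto simp: minus_one_power_iff)
  finally show ?thesis .
qed

lemma card_relations: "16 \<le> card relations"
proof -
  let ?f = "\<lambda>c. \<Sum>Y\<in>evens. sign c Y"
  have "2 ^ 24 * int (card evens) = (\<Sum>Z\<in>Pow points. ?f (odd_rows Z))"
    using card_Pow_points by (simp add: sign_odd_rows)
  also have "\<dots> = (\<Sum>c\<in>Pow R. \<Sum>Z\<in>{Z \<in> Pow points. odd_rows Z = c}. ?f (odd_rows Z))"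
    by (rule sum.group[symmetric]) (use finite_Pow_points finite_R in \<open>auto simp: odd_rows_def\<close>)
  also have "\<dots> = (\<Sum>c\<in>Pow R. int (card {Z \<in> Pow points. odd_rows Z = c}) * ?f c)"
    by (intro sum.cong) auto
  \<comment> \<open>Each nonempty fibre of \<open>odd_rows\<close> is a coset of
    \<open>relations\<close>. Enlarging the coefficients is harmless because the character sums are
    nonnegative.\<close>
  also have "\<dots> \<le> (\<Sum>c\<in>Pow R. int (card relations) * ?f c)"
  proof (intro sum_mono mult_right_mono sign_sum_nonneg)
    fix c
    have "card {Z \<in> Pow points. odd_rows Z = c} \<le> card relations"
      by (rule fibre_card_le(1)[OF finite_Pow_points finite_relations])
        (auto simp: odd_rows_def relations_def even_hits_sym_diff)
    then show "int (card {Z \<in> Pow points. odd_rows Z = c}) \<le> int (card relations)" by simp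
  qed
  also have "\<dots> = int (card relations) * (\<Sum>Y\<in>evens. \<Sum>c\<in>Pow R. sign c Y)"
    by (simp add: sum_distrib_left[symmetric] sum.swap[of _ "Pow R"])
  also have "\<dots> \<le> int (card relations) * (\<Sum>Y\<in>relations. 2 ^ 36)"
  proof (rule mult_left_mono)
    have "(\<Sum>Y\<in>evens. \<Sum>c\<in>Pow R. sign c Y) = (\<Sum>Y\<in>{Y \<in> evens. \<forall>r\<in>R. even (hits Y r)}. 2 ^ 36)"
      unfolding sum_sign sum.inter_filter[OF finite_evens] ..
    also have "\<dots> \<le> (\<Sum>Y\<in>relations. 2 ^ 36)"
      using finite_relations by (intro sum_mono2) (auto simp: relations_def evens_def)
    finally show "(\<Sum>Y\<in>evens. \<Sum>c\<in>Pow R. sign c Y) \<le> (\<Sum>Y\<in>relations. 2 ^ 36)" .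
  qed simp
  finally have "2 ^ 24 * int (card evens) \<le> int (card relations) * (int (card relations) * 2 ^ 36)"
    by simp
  \<comment> \<open>Since \<open>evens\<close> has at least 2^20 members, 2^44 is at most 2^36 times
    the square of \<open>card relations\<close>.\<close>
  moreover have "2 ^ 24 \<le> 16 * int (card evens)" using of_nat_mono[OF card_evens, where 'a = int] by simp
  ultimately have "256 \<le> (int (card relations))\<^sup>2" by (simp add: power2_eq_square)
  then have "16\<^sup>2 \<le> (card relations)\<^sup>2" by (simp flip: of_nat_power)
  then show ?thesis by (rule power2_le_imp_le) simp
qed

text \<open>The inner product of a relation with a point of column \<open>i\<close> is even, so the
  other three columns together contain an even number of its points. The four such parities make
  every column even.\<close>

lemma relations_subset_evens: "relations \<subseteq> evens"
proof
  fix Y assume Y: "Y \<in> relations"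
  then have sub: "Y \<subseteq> points" and ev: "\<And>r. r \<in> R \<Longrightarrow> even (hits Y r)" by (auto simp: relations_def)
  have other: "even (\<Sum>j\<in>{..<4} - {i}. m Y j)" if i: "i < 4" for i
  proof -
    let ?Z = "{(i, 0)}"
    have Z: "?Z \<subseteq> points" using i by (auto simp: points_def)
    have sl: "slice ?Z k = (if k = i then {0} else {})" for k by (auto simp: slice_def)
    have "even (\<Sum>r\<in>R. hits ?Z r * hits Y r)" using ev by (intro dvd_sum) simp
    also have "(\<Sum>r\<in>R. hits ?Z r * hits Y r) = (\<Sum>k<4. if k = i then
        (\<Sum>j<4. if i = j then 6 * card ({0} \<inter> slice Y i) else m Y j) else 0)"
      unfolding sum_hits_mult[OF Z sub] by (intro sum.cong) (auto simp: sl intro!: sum.neutral sum.cong)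
    also have "\<dots> = (\<Sum>j<4. if i = j then 6 * card ({0} \<inter> slice Y i) else m Y j)"
      using i by simp
    also have "\<dots> = 6 * card ({0} \<inter> slice Y i) + (\<Sum>j\<in>{..<4} - {i}. m Y j)"
      using i by (subst sum.remove[of _ i]) (auto intro!: sum.cong)
    finally show ?thesis by simp
  qed
  have "{..<4} - {0} = {1, 2, 3::nat}" "{..<4} - {1} = {0, 2, 3::nat}" "{..<4} - {2} = {0, 1, 3::nat}"
    "{..<4} - {3} = {0, 1, 2::nat}" by auto
  then have "even (m Y 1 + m Y 2 + m Y 3)" "even (m Y 0 + m Y 2 + m Y 3)"
    "even (m Y 0 + m Y 1 + m Y 3)" "even (m Y 0 + m Y 1 + m Y 2)"
    using other[of 0] other[of 1] other[of 2] other[of 3] by (simp_all add: add.assoc)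
  then have "even (m Y 0) \<and> even (m Y 1) \<and> even (m Y 2) \<and> even (m Y 3)" by presburger
  then have "even (m Y i)" if "i < 4" for i
    using that by (auto simp: numeral_eq_Suc less_Suc_eq)
  then show "Y \<in> evens" using sub by (simp add: evens_def)
qed

text \<open>Counting the rows, summing \<open>hits\<close> and summing its squares give the three
  equations; the third is half the difference of the last two sums.\<close>

lemma relation_counts:
  assumes "Y \<in> relations"
  obtains b0 b2 b4 where "b0 + b2 + b4 = 36" "2 * b2 + 4 * b4 = 6 * (m Y 0 + m Y 1 + m Y 2 + m Y 3)"
    "b2 + 6 * b4 = m Y 0 * m Y 1 + m Y 0 * m Y 2 + m Y 0 * m Y 3 + m Y 1 * m Y 2 + m Y 1 * m Y 3 + m Y 2 * m Y 3"
    "(\<exists>i<4. m Y i = 0) \<Longrightarrow> b4 = 0" "m Y 3 = 6 \<Longrightarrow> b0 = 0"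
    "b4 = 0 \<Longrightarrow> (\<forall>r\<in>R. hits Y r \<in> {0, 2})"
proof -
  have sub: "Y \<subseteq> points" and ev: "\<And>r. r \<in> R \<Longrightarrow> even (hits Y r)" using assms by (auto simp: relations_def)
  have four: "(\<Sum>i<4. f i) = f 0 + f 1 + f 2 + f 3" for f :: "nat \<Rightarrow> nat"
    by (simp add: numeral_eq_Suc)
  have le: "hits Y r \<le> 4" for r unfolding hits_def four by (simp add: of_bool_def)
  have cases: "hits Y r \<in> {0, 2, 4}" if "r \<in> R" for r
  proof -
    from ev[OF that] obtain k where "hits Y r = 2 * k" by (rule evenE)
    then show ?thesis using le[of r] by auto
  qed
  define B where "B n = {r \<in> R. hits Y r = n}" for n
  have sumB: "(\<Sum>r\<in>R. g (hits Y r)) = g 0 * card (B 0) + g 2 * card (B 2) + g 4 * card (B 4)"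
    for g :: "nat \<Rightarrow> nat"
  proof -
    have "(\<Sum>r\<in>R. g (hits Y r)) = (\<Sum>n\<in>{0, 2, 4}. \<Sum>r\<in>{r \<in> R. hits Y r = n}. g (hits Y r))"
      by (rule sum.group[symmetric, OF finite_R _ image_subsetI[OF cases]]) simp_all
    also have "\<dots> = (\<Sum>n\<in>{0, 2, 4}. g n * card (B n))"
      by (intro sum.cong) (auto simp: B_def)
    finally show ?thesis by simp
  qed
  have fin: "finite (B n)" for n using finite_R by (simp add: B_def)
  show ?thesis
  proof (rule that[of "card (B 0)" "card (B 2)" "card (B 4)"])
    show "card (B 0) + card (B 2) + card (B 4) = 36"
      using sumB[of "\<lambda>_. 1"] card_R by simp
    show *: "2 * card (B 2) + 4 * card (B 4) = 6 * (m Y 0 + m Y 1 + m Y 2 + m Y 3)"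
      using sumB[of "\<lambda>n. n"] sum_hits[OF sub] by (simp add: four)
    show "card (B 2) + 6 * card (B 4) = m Y 0 * m Y 1 + m Y 0 * m Y 2 + m Y 0 * m Y 3 +
        m Y 1 * m Y 2 + m Y 1 * m Y 3 + m Y 2 * m Y 3"
      using sumB[of "\<lambda>n. n * n"] sum_hits_mult[OF sub sub] * by (simp add: four algebra_simps)
    show "card (B 4) = 0" if "\<exists>i<4. m Y i = 0"
    proof -
      from that obtain i where i: "i < 4" "m Y i = 0" by blast
      then have e: "slice Y i = {}" using finite_slice[OF sub] by simp
      have "hits Y r \<noteq> 4" for r
      proof -
        have "i = 0 \<or> i = 1 \<or> i = 2 \<or> i = 3" using i by auto
        then show ?thesis using e unfolding hits_def four by (auto simp: of_bool_def)
      qed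
      then show ?thesis by (simp add: B_def)
    qed
    show "card (B 0) = 0" if "m Y 3 = 6"
    proof -
      have "slice Y 3 = {..<6}" using slice_subset[OF sub] that by (intro card_subset_eq) auto
      then have "hits Y r \<noteq> 0" if "r \<in> R" for r
        using OA_mem[OF OA that, of 3] unfolding hits_def four by (simp add: of_bool_def)
      then have "B 0 = {}" by (auto simp: B_def)
      then show ?thesis by simp
    qed
    show "\<forall>r\<in>R. hits Y r \<in> {0, 2}" if "card (B 4) = 0"
      using that fin[of 4] cases unfolding B_def by fastforce
  qed
qed

text \<open>
  Among 16 relations two agree at the points \<open>(0, 0)\<close>, \<open>(1, 0)\<close> and \<open>(2, 0)\<close>; their symmetric difference
  contains none of the first three columns.
\<close>

lemma ex_relation:
  obtains Y where "Y \<in> relations" "Y \<noteq> {}" "\<And>i. i < 3 \<Longrightarrow> m Y i \<noteq> 6"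
proof -
  let ?h = "\<lambda>Y. ((0, 0) \<in> Y, (1, 0) \<in> Y, (2, 0) \<in> Y)"
  let ?K = "{Y \<in> relations. \<forall>i<3. (i, 0) \<notin> Y}"
  have fin: "finite ?K" using finite_relations by simp
  have "card relations \<le> card (?h ` relations) * card ?K"
  proof (rule fibre_card_le(2)[OF finite_relations fin])
    fix Y Z assume YZ: "Y \<in> relations" "Z \<in> relations" "?h Y = ?h Z"
    have "(i, 0) \<in> Y \<longleftrightarrow> (i, 0) \<in> Z" if "i < 3" for i
    proof -
      have "i = 0 \<or> i = 1 \<or> i = 2" using that by auto
      then show ?thesis using YZ(3) by auto
    qed
    then show "sym_diff Y Z \<in> ?K" using relations_sym_diff[OF YZ(1,2)] by auto
  qed
  also have "card (?h ` relations) \<le> card (UNIV \<times> UNIV \<times> UNIV :: (bool \<times> bool \<times> bool) set)"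
    by (rule card_mono) simp_all
  also have "\<dots> = 8" by (simp only: card_cartesian_product card_UNIV_bool)
  finally have "2 \<le> card ?K" using card_relations by simp
  then have "\<not> ?K \<subseteq> {{}}"
    using card_mono[of "{{}}" ?K] by auto
  then obtain Y where Y: "Y \<in> relations" "Y \<noteq> {}" "\<forall>i<3. (i, 0) \<notin> Y" by blast
  have "m Y i \<noteq> 6" if "i < 3" for i
  proof
    assume "m Y i = 6"
    moreover have "Y \<subseteq> points" using Y(1) by (simp add: relations_def)
    ultimately have "slice Y i = {..<6}"
      using slice_subset by (intro card_subset_eq) auto
    then have "0 \<in> slice Y i" by simp
    then have "(i, 0) \<in> Y" by (simp add: slice_def)
    then show False using Y(3) that by blast
  qed
  then show ?thesis using that Y by blast
qed

text \<open>Column sizes are even, so finitely many quadruples remain to be tested. The condition on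
  the first three columns excludes the evident relations: a nonempty one contains at least two full
  columns.\<close>

lemma relation_sizes:
  assumes "Y \<in> relations" "Y \<noteq> {}" "\<And>i. i < 3 \<Longrightarrow> m Y i \<noteq> 6"
  shows "\<forall>i<4. m Y i = 2 \<or> m Y i = 4" "even (\<Sum>i<4. of_bool (m Y i = 4) :: nat)"
proof -
  have sub: "Y \<subseteq> points" and ev: "\<And>i. i < 4 \<Longrightarrow> even (m Y i)"
    using assms(1) relations_subset_evens by (auto simp: evens_def)
  have range: "m Y i \<in> {0, 2, 4, 6}" if "i < 4" for i
  proof -
    have "m Y i \<le> 6" using card_mono[OF _ slice_subset[OF sub], of i] by simp
    moreover from ev[OF that] obtain k where "m Y i = 2 * k" by (rule evenE)
    ultimately show ?thesis by auto
  qed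
  have nonzero: "\<exists>i<4. m Y i \<noteq> 0"
  proof -
    obtain i a where ia: "(i, a) \<in> Y" using assms(2) by auto
    then have "i < 4" "a \<in> slice Y i" using sub by (auto simp: points_def slice_def)
    then show ?thesis using finite_slice[OF sub] by auto
  qed
  have ex4: "(\<exists>i<4. P i) \<longleftrightarrow> P 0 \<or> P 1 \<or> P 2 \<or> P 3" for P :: "nat \<Rightarrow> bool"
    by (auto simp: numeral_eq_Suc less_Suc_eq)
  have all4: "(\<forall>i<4. P i) \<longleftrightarrow> P 0 \<and> P 1 \<and> P 2 \<and> P 3" for P :: "nat \<Rightarrow> bool"
    by (auto simp: numeral_eq_Suc less_Suc_eq)
  define a b c d where abcd: "a = m Y 0" "b = m Y 1" "c = m Y 2" "d = m Y 3"
  obtain b0 b2 b4 where B: "b0 + b2 + b4 = 36" "2 * b2 + 4 * b4 = 6 * (a + b + c + d)"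
    "b2 + 6 * b4 = a * b + a * c + a * d + b * c + b * d + c * d"
    "a = 0 \<or> b = 0 \<or> c = 0 \<or> d = 0 \<Longrightarrow> b4 = 0" "d = 6 \<Longrightarrow> b0 = 0"
    using relation_counts[OF assms(1)] unfolding ex4 abcd by metis
  have abc: "a \<in> {0, 2, 4}" "b \<in> {0, 2, 4}" "c \<in> {0, 2, 4}" and d: "d \<in> {0, 2, 4, 6}"
    and nz: "a \<noteq> 0 \<or> b \<noteq> 0 \<or> c \<noteq> 0 \<or> d \<noteq> 0"
    using range[of 0] range[of 1] range[of 2] range[of 3] assms(3)[of 0] assms(3)[of 1] assms(3)[of 2]
      nonzero unfolding ex4 abcd by auto
  define s where "s = a + b + c + d"
  define e where "e = a * b + a * c + a * d + b * c + b * d + c * d"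
  have "4 * b4 + 3 * s = e" using B(2,3) unfolding s_def e_def by linarith
  moreover have "e = 3 * s" if "a = 0 \<or> b = 0 \<or> c = 0 \<or> d = 0"
    using B(4)[OF that] calculation by simp
  moreover have "e + 144 = 15 * s" if "d = 6"
    using B(1,2) B(5)[OF that] calculation unfolding s_def by linarith
  ultimately have feas: "feasible a b c d"
    unfolding feasible_def Let_def s_def[symmetric] e_def[symmetric] by auto
  have check: "\<forall>a\<in>set [0, 2, 4]. \<forall>b\<in>set [0, 2, 4]. \<forall>c\<in>set [0, 2, 4]. \<forall>d\<in>set [0, 2, 4, 6].
      feasible a b c d \<longrightarrow> a = 0 \<and> b = 0 \<and> c = 0 \<and> d = 0 \<or>
        a \<noteq> 0 \<and> b \<noteq> 0 \<and> c \<noteq> 0 \<and> d \<noteq> 0 \<and> d \<noteq> 6 \<and>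
        even (of_bool (a = 4) + of_bool (b = 4) + of_bool (c = 4) + of_bool (d = 4) :: nat)"
    by code_simp
  have "a = 0 \<and> b = 0 \<and> c = 0 \<and> d = 0 \<or> a \<noteq> 0 \<and> b \<noteq> 0 \<and> c \<noteq> 0 \<and> d \<noteq> 0 \<and> d \<noteq> 6 \<and>
      even (of_bool (a = 4) + of_bool (b = 4) + of_bool (c = 4) + of_bool (d = 4) :: nat)"
    by (rule check[rule_format, OF _ _ _ _ feas]) (use abc d in simp_all)
  then have "a \<noteq> 0 \<and> b \<noteq> 0 \<and> c \<noteq> 0 \<and> d \<noteq> 0 \<and> d \<noteq> 6 \<and>
      even (of_bool (a = 4) + of_bool (b = 4) + of_bool (c = 4) + of_bool (d = 4) :: nat)"
    using nz by (elim disjE[of "a = 0 \<and> b = 0 \<and> c = 0 \<and> d = 0"]) simp_all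
  then have "(a = 2 \<or> a = 4) \<and> (b = 2 \<or> b = 4) \<and> (c = 2 \<or> c = 4) \<and> (d = 2 \<or> d = 4)"
    "even (of_bool (a = 4) + of_bool (b = 4) + of_bool (c = 4) + of_bool (d = 4) :: nat)"
    using abc d by auto
  then show "\<forall>i<4. m Y i = 2 \<or> m Y i = 4" "even (\<Sum>i<4. of_bool (m Y i = 4) :: nat)"
    unfolding all4 abcd by (simp_all add: numeral_eq_Suc)
qed

lemma ex_balanced:
  obtains Y where "\<And>i. i < 4 \<Longrightarrow> Y i \<subseteq> {..<6} \<and> card (Y i) = 2"
    "\<And>r. r \<in> R \<Longrightarrow> card {i. i < 4 \<and> w r i \<in> Y i} \<in> {0, 2}"
proof -
  obtain D where D: "D \<in> relations" "D \<noteq> {}" "\<And>i. i < 3 \<Longrightarrow> m D i \<noteq> 6"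
    by (rule ex_relation) blast
  note sizes = relation_sizes[OF D]
  have sub: "D \<subseteq> points" using D(1) by (simp add: relations_def)
  \<comment> \<open>\<open>D\<close> has 4 points in an even number of columns, so the sum of these
    full columns is a relation. Adding it replaces 4 points by the complementary 2.\<close>
  define U where "U = {(i, a) \<in> points. m D i = 4}"
  have slU: "slice U i = (if m D i = 4 then {..<6} else {})" if "i < 4" for i
    using that by (auto simp: slice_def U_def points_def)
  have "hits U r = (\<Sum>i<4. of_bool (m D i = 4))" if "r \<in> R" for r
    unfolding hits_def using OA_mem[OF OA that] by (intro sum.cong) (auto simp: slU)
  then have "U \<in> relations" using sizes(2) by (auto simp: relations_def U_def)
  define Y where "Y = sym_diff D U"
  have Y: "Y \<in> relations" unfolding Y_def by (rule relations_sym_diff) fact+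
  have m: "m Y i = 2" if "i < 4" for i
  proof -
    have sl: "slice Y i = (if m D i = 4 then {..<6} - slice D i else slice D i)"
      using slU[OF that] slice_subset[OF sub, of i]
      unfolding Y_def slice_def by (auto split: if_splits)
    show ?thesis
    proof (cases "m D i = 4")
      case True
      then show ?thesis
        using sl slice_subset[OF sub, of i] by (simp add: card_Diff_subset finite_slice[OF sub])
    next
      case False
      then show ?thesis using sl sizes(1) that by auto
    qed
  qed
  have hits: "hits Y r \<in> {0, 2}" if r: "r \<in> R" for r
  proof -
    \<comment> \<open>With two points in each column, \<open>2 * b2 + 4 * b4 = 48\<close> and
      \<open>b2 + 6 * b4 = 24\<close>, which forces \<open>b4 = 0\<close>.\<close>
    obtain b0 b2 b4 where "b0 + b2 + b4 = 36" "2 * b2 + 4 * b4 = 6 * (m Y 0 + m Y 1 + m Y 2 + m Y 3)"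
      "b2 + 6 * b4 = m Y 0 * m Y 1 + m Y 0 * m Y 2 + m Y 0 * m Y 3 + m Y 1 * m Y 2 + m Y 1 * m Y 3 + m Y 2 * m Y 3"
      "b4 = 0 \<Longrightarrow> (\<forall>r\<in>R. hits Y r \<in> {0, 2})"
      using relation_counts[OF Y] by metis
    then show ?thesis using m[of 0] m[of 1] m[of 2] m[of 3] r by simp
  qed
  show ?thesis
  proof (rule that[of "slice Y"])
    show "slice Y i \<subseteq> {..<6} \<and> card (slice Y i) = 2" if "i < 4" for i
      using m[OF that] slice_subset[of Y i] Y by (simp add: relations_def)
    show "card {i. i < 4 \<and> w r i \<in> slice Y i} \<in> {0, 2}" if "r \<in> R" for r
    proof -
      have "hits Y r = card {i. i < 4 \<and> w r i \<in> slice Y i}"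
        unfolding hits_def by (simp add: sum_of_bool_eq Collect_conj_eq lessThan_def)
      then show ?thesis using hits[OF that] by simp
    qed
  qed
qed

end

section \<open>Exhaustive search on 4 x 4 arrays\<close>

text \<open>
  Symbols outside \<open>Y j\<close> are matched with those outside \<open>Y 0\<close> in \<open>contradiction\<close> below; after this
  identification a row avoiding \<open>Y\<close> has in each later column a label other than its label \<open>p\<close> in
  column 0, and \<open>L p q\<close> is its label in column 2 or 3 if \<open>q\<close> is the label in column 1.
\<close>

definition holey :: "(nat \<Rightarrow> nat \<Rightarrow> nat) \<Rightarrow> bool" where
  "holey L \<longleftrightarrow> (\<forall>p<4. \<forall>q<4. p \<noteq> q \<longrightarrow> L p q < 4 \<and> L p q \<noteq> p) \<and>
     (\<forall>p<4. \<forall>q<4. \<forall>q'<4. p \<noteq> q \<longrightarrow> p \<noteq> q' \<longrightarrow> L p q = L p q' \<longrightarrow> q = q') \<and>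
     (\<forall>p<4. \<forall>p'<4. \<forall>q<4. p \<noteq> q \<longrightarrow> p' \<noteq> q \<longrightarrow> L p q = L p' q \<longrightarrow> p = p') \<and>
     (\<forall>q<4. \<exists>p<4. p \<noteq> q \<and> L p q = q)"

definition orders :: "'a \<Rightarrow> 'a \<Rightarrow> 'a \<Rightarrow> 'a list list" where
  "orders a b c = [[a, b, c], [a, c, b], [b, a, c], [b, c, a], [c, a, b], [c, b, a]]"

text \<open>The entry \<open>4 + p\<close> fills the unused cell \<open>(p, p)\<close>.\<close>

definition row_choices :: "nat list list list" where
  "row_choices = [map (\<lambda>r. 4 # r) (orders 1 2 3),
     map (\<lambda>r. hd r # 5 # tl r) (orders 0 2 3),
     map (\<lambda>r. hd r # hd (tl r) # 6 # tl (tl r)) (orders 0 1 3),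
     map (\<lambda>r. r @ [7]) (orders 0 1 2)]"

text \<open>The column condition prunes partial arrays, which keeps the enumeration small.\<close>

fun stack :: "'a list list list \<Rightarrow> 'a list list list" where
  "stack [] = [[]]"
| "stack (rs # rss) =
     concat (map (\<lambda>l. map (\<lambda>r. r # l) (filter (\<lambda>r. list_all (list_all2 (\<noteq>) r) l) rs)) (stack rss))"

text \<open>Negated \<open>distinct\<close>, written with \<open>if\<close> so that evaluation can
  stop at the first repetition.\<close>

fun repeats :: "'a list \<Rightarrow> bool" where
  "repeats [] = False"
| "repeats (x # xs) = (if x \<in> set xs then True else repeats xs)"

text \<open>The filter is the last condition of \<open>holey\<close>; the diagonal entries are at
  least 4 and cannot satisfy it.\<close>

definition arrays :: "nat list list list" where
  "arrays = filter (\<lambda>l. list_all (\<lambda>q. q \<in> set (map (\<lambda>r. r ! q) l)) [0, 1, 2, 3]) (stack row_choices)"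

definition no_pair :: "nat list list list \<Rightarrow> bool" where
  "no_pair ls \<longleftrightarrow> list_all (\<lambda>l. list_all (\<lambda>l'. repeats (zip (concat l) (concat l'))) ls) ls"

lemma repeats_iff: "repeats xs \<longleftrightarrow> \<not> distinct xs"
  by (induction xs) auto

lemma arrays_not_orthogonal:
  assumes "l \<in> set arrays" "l' \<in> set arrays"
  shows "\<not> distinct (zip (concat l) (concat l'))"
proof -
  have "no_pair arrays" by code_simp
  then show ?thesis using assms by (simp add: no_pair_def list_all_iff repeats_iff)
qed

lemma stack_mem:
  assumes "list_all2 (\<lambda>r rs. r \<in> set rs) l rss" "sorted_wrt (list_all2 (\<noteq>)) l"
  shows "l \<in> set (stack rss)"
  using assms
proof (induction l rss rule: list_all2_induct)
  case (Cons r l rs rss)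
  then show ?case by (auto simp: list_all_iff intro!: bexI[of _ l])
qed simp

lemma holeyD:
  assumes "holey L"
  shows "\<lbrakk>p < 4; q < 4; p \<noteq> q\<rbrakk> \<Longrightarrow> L p q < 4 \<and> L p q \<noteq> p"
    and "\<lbrakk>p < 4; q < 4; q' < 4; p \<noteq> q; p \<noteq> q'; L p q = L p q'\<rbrakk> \<Longrightarrow> q = q'"
    and "\<lbrakk>p < 4; p' < 4; q < 4; p \<noteq> q; p' \<noteq> q; L p q = L p' q\<rbrakk> \<Longrightarrow> p = p'"
    and "q < 4 \<Longrightarrow> \<exists>p<4. p \<noteq> q \<and> L p q = q"
proof -
  note conj = assms[unfolded holey_def]
  note 1 = conj[THEN conjunct1] and 2 = conj[THEN conjunct2, THEN conjunct1]
    and 3 = conj[THEN conjunct2, THEN conjunct2, THEN conjunct1]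
    and 4 = conj[THEN conjunct2, THEN conjunct2, THEN conjunct2]
  show "\<lbrakk>p < 4; q < 4; p \<noteq> q\<rbrakk> \<Longrightarrow> L p q < 4 \<and> L p q \<noteq> p" by (rule 1[rule_format])
  show "\<lbrakk>p < 4; q < 4; q' < 4; p \<noteq> q; p \<noteq> q'; L p q = L p q'\<rbrakk> \<Longrightarrow> q = q'" by (rule 2[rule_format])
  show "\<lbrakk>p < 4; p' < 4; q < 4; p \<noteq> q; p' \<noteq> q; L p q = L p' q\<rbrakk> \<Longrightarrow> p = p'" by (rule 3[rule_format])
  show "q < 4 \<Longrightarrow> \<exists>p<4. p \<noteq> q \<and> L p q = q" by (rule 4[rule_format])
qed

lemma orders_mem:
  assumes "x \<in> {a, b, c}" "y \<in> {a, b, c}" "z \<in> {a, b, c}" "x \<noteq> y" "x \<noteq> z" "y \<noteq> z"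
  shows "[x, y, z] \<in> set (orders a b c)"
  using assms by (auto simp: orders_def)

lemma ex4: "(\<exists>i<4. P i) \<longleftrightarrow> P 0 \<or> P 1 \<or> P 2 \<or> P (3::nat)"
  by (auto simp: numeral_eq_Suc less_Suc_eq)

definition table :: "(nat \<Rightarrow> nat \<Rightarrow> nat) \<Rightarrow> nat list list" where
  "table L = [[4, L 0 1, L 0 2, L 0 3], [L 1 0, 5, L 1 2, L 1 3],
     [L 2 0, L 2 1, 6, L 2 3], [L 3 0, L 3 1, L 3 2, 7]]"

lemma table_mem_arrays:
  assumes "holey L"
  shows "table L \<in> set arrays"
proof -
  note val = holeyD(1)[OF assms] and diag = holeyD(4)[OF assms]
  have row: "L p q \<noteq> L p q'" if "p < 4" "q < 4" "q' < 4" "p \<noteq> q" "p \<noteq> q'" "q \<noteq> q'" for p q q'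
    using holeyD(2)[OF assms] that by blast
  have col: "L p q \<noteq> L p' q" if "p < 4" "p' < 4" "q < 4" "p \<noteq> q" "p' \<noteq> q" "p \<noteq> p'" for p p' q
    using holeyD(3)[OF assms] that by blast
  have vals: "L p q \<in> {0, 1, 2, 3} - {p}" if "p < 4" "q < 4" "p \<noteq> q" for p q
    using val[OF that] by auto
  have big: "L p q \<noteq> n" "n \<noteq> L p q" if "p < 4" "q < 4" "p \<noteq> q" "4 \<le> n" for p q n
    using val[OF that(1-3)] that(4) by auto
  have row0: "[L 0 1, L 0 2, L 0 3] \<in> set (orders 1 2 3)"
    using vals[of 0 1] vals[of 0 2] vals[of 0 3] by (intro orders_mem; simp add: row)
  have row1: "[L 1 0, L 1 2, L 1 3] \<in> set (orders 0 2 3)"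
    using vals[of 1 0] vals[of 1 2] vals[of 1 3] by (intro orders_mem; simp add: row)
  have row2: "[L 2 0, L 2 1, L 2 3] \<in> set (orders 0 1 3)"
    using vals[of 2 0] vals[of 2 1] vals[of 2 3] by (intro orders_mem; simp add: row)
  have row3: "[L 3 0, L 3 1, L 3 2] \<in> set (orders 0 1 2)"
    using vals[of 3 0] vals[of 3 1] vals[of 3 2] by (intro orders_mem; simp add: row)
  have "table L \<in> set (stack row_choices)"
  proof (rule stack_mem)
    show "list_all2 (\<lambda>r rs. r \<in> set rs) (table L) row_choices"
      unfolding table_def row_choices_def list_all2_Cons list_all2_Nil set_map
      using row0 row1 row2 row3 by (intro conjI refl) (rule image_eqI[rotated], assumption, simp)+
    show "sorted_wrt (list_all2 (\<noteq>)) (table L)"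
      by (simp add: table_def col big)
  qed
  then show ?thesis
    using diag[of 0] diag[of 1] diag[of 2] diag[of 3] unfolding ex4
    by (auto simp: arrays_def table_def)
qed

text \<open>The filled diagonal cells contribute the pairs \<open>(4 + p, 4 + p)\<close>, different
  from each other and from all pairs of entries below 4. So orthogonality off the diagonal extends
  to the full tables, against the search.\<close>

lemma holey_not_orthogonal:
  assumes "holey L" "holey L'"
    and orth: "\<And>p q p' q'. \<lbrakk>p < 4; q < 4; p' < 4; q' < 4; p \<noteq> q; p' \<noteq> q'; L p q = L p' q'; L' p q = L' p' q'\<rbrakk>
      \<Longrightarrow> p = p' \<and> q = q'"
  shows False
proof -
  define ext where "ext L p q = (if p = q then 4 + p else L p q)" for L :: "nat \<Rightarrow> nat \<Rightarrow> nat" and p q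
  define cells :: "(nat \<times> nat) list" where "cells = List.product [0..<4] [0..<4]"
  have concat: "concat (table L) = map (\<lambda>(p, q). ext L p q) cells" for L
    by (simp add: cells_def table_def ext_def upt_rec numeral_eq_Suc)
  have less: "L p q < 4" "L' p q < 4" if "p < 4" "q < 4" "p \<noteq> q" for p q
    using holeyD(1)[OF assms(1)] holeyD(1)[OF assms(2)] that by simp_all
  have "inj_on (\<lambda>(p, q). (ext L p q, ext L' p q)) (set cells)"
  proof (rule inj_onI, clarify)
    fix p q p' q' assume mem: "(p, q) \<in> set cells" "(p', q') \<in> set cells"
      and eq: "ext L p q = ext L p' q'" "ext L' p q = ext L' p' q'"
    have lt: "p < 4" "q < 4" "p' < 4" "q' < 4" using mem by (auto simp: cells_def)
    show "p = p' \<and> q = q'"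
      using eq orth[OF lt] less[OF lt(1,2)] less[OF lt(3,4)] by (auto simp: ext_def split: if_splits)
  qed
  moreover have "distinct cells" by (simp add: cells_def distinct_product)
  ultimately have "distinct (map (\<lambda>(p, q). (ext L p q, ext L' p q)) cells)" by (simp add: distinct_map)
  also have "map (\<lambda>(p, q). (ext L p q, ext L' p q)) cells = zip (concat (table L)) (concat (table L'))"
    unfolding concat zip_map_map by (simp add: zip_same_conv_map split_def)
  finally show False
    using arrays_not_orthogonal[OF table_mem_arrays table_mem_arrays] assms(1,2) by blast
qed

section \<open>From a balanced relation to two orthogonal 4 x 4 arrays\<close>

locale balanced = OA_4_6 R w for R :: "'r set" and w +
  fixes Y :: "nat \<Rightarrow> nat set"
  assumes Y: "i < 4 \<Longrightarrow> Y i \<subseteq> {..<6} \<and> card (Y i) = 2"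
    and meets: "r \<in> R \<Longrightarrow> card {i. i < 4 \<and> w r i \<in> Y i} \<in> {0, 2}"
begin

definition H :: "'r \<Rightarrow> nat set" where "H r = {i. i < 4 \<and> w r i \<in> Y i}"

lemma H_cases: "r \<in> R \<Longrightarrow> H r = {} \<or> card (H r) = 2"
  using meets[of r] by (auto simp: H_def)

lemma H_eq:
  assumes "r \<in> R" "k \<in> H r" "l \<in> H r" "k \<noteq> l"
  shows "H r = {k, l}"
proof -
  have "finite (H r)" by (simp add: H_def)
  moreover have "card (H r) = 2" using H_cases[OF assms(1)] assms(2) by auto
  ultimately show ?thesis using assms card_subset_eq[of "H r" "{k, l}"] by auto
qed

lemma row_eq:
  assumes "r \<in> R" "r' \<in> R" "i < 4" "j < 4" "i \<noteq> j" "w r i = w r' i" "w r j = w r' j"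
  shows "r = r'"
  using packing_eq[OF OA_imp_packing[OF OA]] assms by blast

text \<open>Among the rows with symbol \<open>z\<close> in column \<open>i\<close>, two meet
  \<open>Y a\<close> for each other column \<open>a\<close>, and each of these meets
  \<open>Y\<close> in exactly one further column. The three equations for the three pairs of columns
  make every count 1.\<close>

lemma ex1_row:
  assumes ijkl: "{i, j, k, l} = {..<4}" "distinct [i, j, k, l]" and z: "z < 6" "z \<notin> Y i"
  shows "\<exists>!r. r \<in> R \<and> w r i = z \<and> H r = {k, l}"
proof -
  have lt: "i < 4" "j < 4" "k < 4" "l < 4" using ijkl(1) by blast+
  define B where "B a b = {r \<in> R. w r i = z \<and> a \<in> H r \<and> b \<in> H r}" for a b
  have fin: "finite (B a b)" for a b using finite_R by (simp add: B_def)
  have comm: "B a b = B b a" for a b by (auto simp: B_def)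
  have two: "card (B a b) + card (B a c) = 2"
    if abc: "{i, a, b, c} = {..<4}" "distinct [i, a, b, c]" for a b c
  proof -
    have a: "a < 4" using abc(1) by blast
    have "B a b \<inter> B a c = {}"
    proof (rule ccontr)
      assume "B a b \<inter> B a c \<noteq> {}"
      then obtain r where "r \<in> R" "a \<in> H r" "b \<in> H r" "c \<in> H r" by (auto simp: B_def)
      then show False using H_eq[of r a b] abc(2) by auto
    qed
    moreover have "B a b \<union> B a c = {r \<in> R. w r i \<in> {z} \<and> w r a \<in> Y a}"
    proof (intro equalityI subsetI)
      fix r assume r: "r \<in> {r \<in> R. w r i \<in> {z} \<and> w r a \<in> Y a}"
      then have aH: "a \<in> H r" and iH: "i \<notin> H r" using a z by (auto simp: H_def)
      then have "card (H r) = 2" using H_cases[of r] r by auto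
      then obtain x where x: "x \<in> H r" "x \<noteq> a"
        by (metis card_2_iff insertCI)
      then have "x \<in> {i, a, b, c}" unfolding abc(1) by (simp add: H_def)
      then have "x = b \<or> x = c" using x iH by auto
      then show "r \<in> B a b \<union> B a c" using x aH r by (auto simp: B_def)
    qed (auto simp: B_def H_def)
    moreover have "card {r \<in> R. w r i \<in> {z} \<and> w r a \<in> Y a} = 2"
      using OA_pair_count[OF OA _ lt(1) a, of "{z}" "Y a"] Y[OF a] z abc(2) by simp
    ultimately show ?thesis using card_Un_disjoint[OF fin fin, of a b a c] by simp
  qed
  have "{i, k, l, j} = {..<4}" "{i, l, k, j} = {..<4}" "{i, j, k, l} = {..<4}"
    using ijkl(1) by (simp_all add: insert_commute)
  then have "card (B k l) + card (B k j) = 2" "card (B l k) + card (B l j) = 2" "card (B j k) + card (B j l) = 2"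
    using ijkl(2) two[of k l j] two[of l k j] two[of j k l] by auto
  then have "card (B k l) = 1" unfolding comm[of l k] comm[of j k] comm[of j l] by linarith
  then obtain x where x: "B k l = {x}" by (rule card_1_singletonE)
  have "r \<in> R \<and> w r i = z \<and> H r = {k, l} \<longleftrightarrow> r = x" for r
  proof -
    have "r \<in> R \<and> w r i = z \<and> H r = {k, l} \<longleftrightarrow> r \<in> B k l"
    proof
      assume "r \<in> B k l"
      then have "r \<in> R" "w r i = z" "k \<in> H r" "l \<in> H r" by (simp_all add: B_def)
      then show "r \<in> R \<and> w r i = z \<and> H r = {k, l}" using H_eq[of r k l] ijkl(2) by simp
    qed (simp add: B_def)
    then show ?thesis unfolding x by simp
  qed
  then show ?thesis by simp
qed

text \<open>The three rows pairwise agree in one column, so their symbols in \<open>Y l\<close> would be distinct.\<close>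

lemma no_triangle:
  assumes ijkl: "{i, j, k, l} = {..<4}" "distinct [i, j, k, l]"
    and R: "r1 \<in> R" "r2 \<in> R" "r3 \<in> R"
    and H: "H r1 = {k, l}" "H r2 = {j, l}" "H r3 = {i, l}"
    and eq: "w r1 i = w r2 i" "w r1 j = w r3 j" "w r2 k = w r3 k"
  shows False
proof -
  have lt: "i < 4" "j < 4" "k < 4" "l < 4" using ijkl(1) by blast+
  have "l \<in> H r1" "l \<in> H r2" "l \<in> H r3" using H by auto
  then have mem: "w r1 l \<in> Y l" "w r2 l \<in> Y l" "w r3 l \<in> Y l" by (simp_all add: H_def)
  obtain a b where "Y l = {a, b}" using Y[OF lt(4)] by (meson card_2_iff)
  then have "w r1 l = w r2 l \<or> w r1 l = w r3 l \<or> w r2 l = w r3 l"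
    using mem by auto
  then have "r1 = r2 \<or> r1 = r3 \<or> r2 = r3"
    using row_eq[OF R(1,2) lt(1,4)] row_eq[OF R(1,3) lt(2,4)] row_eq[OF R(2,3) lt(3,4)] eq ijkl(2)
    by auto
  moreover have "k \<in> H r1" "k \<notin> H r2" "k \<notin> H r3" "j \<in> H r2" "j \<notin> H r3" using H ijkl(2) by auto
  ultimately show False by auto
qed

lemma card_compl:
  assumes "i < 4"
  shows "card ({..<6} - Y i) = 4"
proof -
  have "finite (Y i)" using Y[OF assms] finite_subset by blast
  then show ?thesis using Y[OF assms] by (simp add: card_Diff_subset)
qed

lemma contradiction: False
proof -
  have "card ({..<6} - Y 0) = 4" by (rule card_compl) simp
  then obtain e :: "nat \<Rightarrow> nat" where e: "bij_betw e {..<4} ({..<6} - Y 0)"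
    using finite_same_card_bij[of "{..<4::nat}" "{..<6} - Y 0"] by auto
  have eY: "e p < 6" "e p \<notin> Y 0" if "p < 4" for p
    using bij_betwE[OF e] that by auto
  have e_inj: "p = p'" if "e p = e p'" "p < 4" "p' < 4" for p p'
    using e that unfolding bij_betw_def inj_on_def by blast
  have e_ex: "\<exists>p<4. e p = z" if "z < 6" "z \<notin> Y 0" for z
  proof -
    have "z \<in> e ` {..<4}" using e that unfolding bij_betw_def by auto
    then show ?thesis by auto
  qed
  let ?J = "{1, 2, 3 :: nat}"
  have split: "\<exists>k l. {0, j, k, l} = {..<4} \<and> distinct [0, j, k, l] \<and> ?J - {j} = {k, l}"
    if "j \<in> ?J" for j
  proof -
    have "{0, 1, 2, 3} = {..<4::nat}" "{0, 2, 1, 3} = {..<4::nat}" "{0, 3, 1, 2} = {..<4::nat}" by auto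
    moreover have "?J - {1} = {2, 3}" "?J - {2} = {1, 3}" "?J - {3} = {1, 2}" by auto
    ultimately show ?thesis using that
      by (elim insertE emptyE) (force intro: exI[of _ 1] exI[of _ 2] exI[of _ 3])+
  qed
  \<comment> \<open>\<open>rho j p\<close> has symbol \<open>e p\<close> in column 0 and meets
    \<open>Y\<close> in the two columns other than 0 and \<open>j\<close>. Its symbol in column
    \<open>j\<close> becomes the partner \<open>f j p\<close> of \<open>e p\<close>.\<close>
  have ex_rho: "\<exists>!r. r \<in> R \<and> w r 0 = e p \<and> H r = ?J - {j}" if "j \<in> ?J" "p < 4" for j p
  proof -
    from split[OF that(1)] obtain k l
      where "{0, j, k, l} = {..<4}" "distinct [0, j, k, l]" "?J - {j} = {k, l}" by blast
    then show ?thesis using ex1_row[of 0 j k l "e p"] eY[OF that(2)] by simp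
  qed
  then obtain rho where rho: "\<And>j p. j \<in> ?J \<Longrightarrow> p < 4 \<Longrightarrow> rho j p \<in> R \<and> w (rho j p) 0 = e p \<and> H (rho j p) = ?J - {j}"
    by metis
  have rho_eq: "r = rho j p" if "j \<in> ?J" "p < 4" "r \<in> R" "w r 0 = e p" "H r = ?J - {j}" for r j p
    using ex_rho[OF that(1,2)] rho[OF that(1,2)] that(3-5) by blast
  \<comment> \<open>The uniqueness of \<open>ex1_row\<close> seen from column \<open>j\<close>
    instead of 0; it makes \<open>f j\<close> injective.\<close>
  have other_eq: "r = r'" if "j \<in> ?J" "r \<in> R" "r' \<in> R" "w r j = w r' j" "H r = ?J - {j}" "H r' = ?J - {j}" for j r r'
  proof -
    from split[OF that(1)] obtain k l
      where kl: "{0, j, k, l} = {..<4}" "distinct [0, j, k, l]" "?J - {j} = {k, l}" by blast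
    have "{j, 0, k, l} = {..<4}" using kl(1) by (simp add: insert_commute)
    moreover have "j < 4" using that(1) by auto
    moreover have "w r j \<notin> Y j"
    proof -
      have "j \<notin> H r" unfolding that(5) by simp
      then show ?thesis using \<open>j < 4\<close> by (simp add: H_def)
    qed
    moreover have "w r j < 6" using OA_mem[OF OA that(2) \<open>j < 4\<close>] by simp
    ultimately have "\<exists>!x. x \<in> R \<and> w x j = w r j \<and> H x = {k, l}"
      using ex1_row[of j 0 k l "w r j"] kl(2) by auto
    then show ?thesis using that kl(3) by metis
  qed
  define f where "f j p = w (rho j p) j" for j p
  have J4: "j < 4" "j \<noteq> 0" if "j \<in> ?J" for j using that by auto
  have f_mem: "f j p \<in> {..<6} - Y j" if "j \<in> ?J" "p < 4" for j p
  proof -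
    have "j \<notin> H (rho j p)" using rho[OF that] by simp
    then show ?thesis
      using J4[OF that(1)] OA_mem[OF OA, of "rho j p" j] rho[OF that] by (simp add: H_def f_def)
  qed
  have f_inj: "p = p'" if "f j p = f j p'" "j \<in> ?J" "p < 4" "p' < 4" for j p p'
  proof -
    have "rho j p = rho j p'"
      by (rule other_eq[OF that(2)]) (use rho[OF that(2,3)] rho[OF that(2,4)] that(1) in \<open>simp_all add: f_def\<close>)
    then show ?thesis using rho[OF that(2,3)] rho[OF that(2,4)] e_inj that(3,4) by metis
  qed
  have f_bij: "bij_betw (f j) {..<4} ({..<6} - Y j)" if "j \<in> ?J" for j
  proof -
    have inj: "inj_on (f j) {..<4}" using f_inj that by (auto intro: inj_onI)
    have "card ({..<6} - Y j) = 4" using card_compl J4(1)[OF that] .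
    then have "f j ` {..<4} = {..<6} - Y j"
      using f_mem[OF that] inj by (intro card_subset_eq) (auto simp: card_image)
    then show ?thesis using inj by (simp add: bij_betw_def)
  qed
  have f_ex: "\<exists>p<4. f j p = z" if "j \<in> ?J" "z < 6" "z \<notin> Y j" for j z
  proof -
    have "z \<in> f j ` {..<4}" using f_bij[OF that(1)] that(2,3) unfolding bij_betw_def by auto
    then show ?thesis by auto
  qed
  \<comment> \<open>A row with equal labels in columns 0 and \<open>j\<close> is
    \<open>rho j p\<close>, which meets \<open>Y\<close>. Conversely, a row with symbols outside
    \<open>Y\<close> in both columns can meet \<open>Y\<close> only in the other two, which makes it
    \<open>rho j p\<close> with equal labels.\<close>
  have H0: "H r = {} \<longleftrightarrow> p \<noteq> q"
    if "j \<in> ?J" "r \<in> R" "p < 4" "q < 4" "w r 0 = e p" "w r j = f j q" for j r p q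
  proof
    assume "H r = {}"
    show "p \<noteq> q"
    proof
      assume "p = q"
      then have "r = rho j p"
        using row_eq[OF that(2), of "rho j p" 0 j] rho[OF that(1,3)] J4[OF that(1)] that(5,6) by (simp add: f_def)
      then show False using rho[OF that(1,3)] \<open>H r = {}\<close> by auto
    qed
  next
    assume "p \<noteq> q"
    show "H r = {}"
    proof (rule ccontr)
      assume "H r \<noteq> {}"
      then have "card (H r) = 2" using H_cases[OF that(2)] by simp
      moreover have "H r \<subseteq> ?J - {j}"
      proof
        fix x assume "x \<in> H r"
        then have x: "x < 4" "w r x \<in> Y x" by (simp_all add: H_def)
        then have "x \<noteq> 0" using eY[OF that(3)] that(5) by (cases "x = 0") auto
        moreover have "x \<noteq> j" using x f_mem[OF that(1,4)] that(6) by auto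
        ultimately show "x \<in> ?J - {j}" using x(1) by auto
      qed
      moreover have "card (?J - {j}) = 2" using that(1) by auto
      ultimately have "H r = ?J - {j}" by (intro card_subset_eq) simp_all
      then have "r = rho j p" by (rule rho_eq[OF that(1,3,2,5)])
      then have "f j p = f j q" using that(6) by (simp add: f_def)
      then show False using f_inj[OF _ that(1,3,4)] \<open>p \<noteq> q\<close> by simp
    qed
  qed
  have "\<exists>r\<in>R. w r 0 = e p \<and> w r 1 = f 1 q" if "p < 4" "q < 4" for p q
    using OA_ex[OF OA, of 0 1 "e p" "f 1 q"] eY[OF that(1)] f_mem[of 1 q] that(2) by auto
  then obtain row where row: "\<And>p q. p < 4 \<Longrightarrow> q < 4 \<Longrightarrow> row p q \<in> R \<and> w (row p q) 0 = e p \<and> w (row p q) 1 = f 1 q"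
    by metis
  have row_inj: "p = p' \<and> q = q'" if "row p q = row p' q'" "p < 4" "q < 4" "p' < 4" "q' < 4" for p q p' q'
    using row[OF that(2,3)] row[OF that(4,5)] that e_inj f_inj[of 1 q q'] by auto
  \<comment> \<open>Meaningful off the diagonal only: there \<open>row p q\<close> avoids
    \<open>Y\<close> by \<open>H0\<close>, so its symbol in column \<open>j\<close> is a value of
    \<open>f j\<close>.\<close>
  define L where "L j p q = inv_into {..<4} (f j) (w (row p q) j)" for j p q
  have L: "L j p q < 4 \<and> f j (L j p q) = w (row p q) j"
    if "j \<in> ?J" "p < 4" "q < 4" "p \<noteq> q" for j p q
  proof -
    have "H (row p q) = {}" using H0[of 1 "row p q" p q] row that by simp
    then have "w (row p q) j \<notin> Y j" using J4[OF that(1)] by (auto simp: H_def)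
    moreover have "w (row p q) j < 6" using OA_mem[OF OA _ J4(1)[OF that(1)]] row[OF that(2,3)] by auto
    ultimately have "w (row p q) j \<in> f j ` {..<4}" using f_bij[OF that(1)] unfolding bij_betw_def by auto
    then show ?thesis unfolding L_def using inv_into_into[of _ "f j" "{..<4}"] f_inv_into_f[of _ "f j" "{..<4}"] by fast
  qed
  have holey: "holey (L j)" if j: "j \<in> {2, 3}" for j
  proof -
    have jJ: "j \<in> ?J" and j1: "j < 4" "j \<noteq> 0" "j \<noteq> 1" using j by auto
    show ?thesis unfolding holey_def
    proof (intro conjI allI impI)
      fix p q :: nat assume pq: "p < 4" "q < 4" "p \<noteq> q"
      show "L j p q < 4" using L[OF jJ pq] by simp
      show "L j p q \<noteq> p"
        using H0[of j "row p q" p "L j p q"] H0[of 1 "row p q" p q] L[OF jJ pq] row[OF pq(1,2)] pq jJ by auto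
    next
      fix p q q' :: nat assume pq: "p < 4" "q < 4" "q' < 4" "p \<noteq> q" "p \<noteq> q'" "L j p q = L j p q'"
      have "row p q = row p q'"
        using row_eq[of "row p q" "row p q'" 0 j] row[OF pq(1,2)] row[OF pq(1,3)] j1
          L[OF jJ pq(1,2,4)] L[OF jJ pq(1,3,5)] pq(6) by simp
      then show "q = q'" using row_inj pq by blast
    next
      fix p p' q :: nat assume pq: "p < 4" "p' < 4" "q < 4" "p \<noteq> q" "p' \<noteq> q" "L j p q = L j p' q"
      have "row p q = row p' q"
        using row_eq[of "row p q" "row p' q" 1 j] row[OF pq(1,3)] row[OF pq(2,3)] j1
          L[OF jJ pq(1,3,4)] L[OF jJ pq(2,3,5)] pq(6) by simp
      then show "p = p'" using row_inj pq by blast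
    next
      fix q :: nat assume q: "q < 4"
      \<comment> \<open>The row with label \<open>q\<close> in columns 1 and \<open>j\<close>. If it
        met \<open>Y\<close>, it would do so in columns 0 and \<open>l\<close>, and form a forbidden
        triangle with \<open>rho 1 q\<close> and \<open>rho j q\<close>.\<close>
      obtain r where r: "r \<in> R" "w r 1 = f 1 q" "w r j = f j q"
        using OA_ex[OF OA, of 1 j "f 1 q" "f j q"] f_mem[OF _ q, of 1] f_mem[OF jJ q] j1 by auto
      have out: "1 \<notin> H r" "j \<notin> H r"
        using r f_mem[OF _ q, of 1] f_mem[OF jJ q] by (auto simp: H_def)
      define l where "l = (if j = 2 then 3 else 2 :: nat)"
      have l: "{0, 1, j, l} = {..<4}" "distinct [0, 1, j, l]" "?J - {1} = {j, l}" "?J - {j} = {1, l}"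
        using j by (auto simp: l_def)
      have "H r = {}"
      proof (rule ccontr)
        assume "H r \<noteq> {}"
        then have "card (H r) = 2" using H_cases[OF r(1)] by simp
        moreover have "H r \<subseteq> {0, l}"
        proof
          fix x assume x: "x \<in> H r"
          then have "x \<in> {0, 1, j, l}" unfolding l(1) by (simp add: H_def)
          then show "x \<in> {0, l}" using x out by auto
        qed
        moreover have "card {0, l} = 2" using l(2) by simp
        ultimately have "H r = {0, l}" by (intro card_subset_eq) simp_all
        then show False
          using no_triangle[OF l(1,2), of "rho 1 q" "rho j q" r] rho[OF _ q, of 1] rho[OF jJ q] r l(3,4)
          by (simp add: f_def)
      qed
      then have "w r 0 \<notin> Y 0" by (auto simp: H_def)
      moreover have "w r 0 < 6" using OA_mem[OF OA r(1), of 0] by simp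
      ultimately obtain p where p: "p < 4" "e p = w r 0" using e_ex by blast
      have pq: "p \<noteq> q" using H0[of 1 r p q] \<open>H r = {}\<close> r p q by simp
      have "row p q = r" using row_eq[of "row p q" r 0 1] row[OF p(1) q] r p by simp
      then have "f j (L j p q) = f j q" using L[OF jJ p(1) q pq] r by simp
      then have "L j p q = q" using f_inj[OF _ jJ] L[OF jJ p(1) q pq] q by blast
      then show "\<exists>p<4. p \<noteq> q \<and> L j p q = q" using p pq by blast
    qed
  qed
  show False
  proof (rule holey_not_orthogonal[OF holey[of 2] holey[of 3]])
    fix p q p' q' :: nat
    assume pq: "p < 4" "q < 4" "p' < 4" "q' < 4" "p \<noteq> q" "p' \<noteq> q'" "L 2 p q = L 2 p' q'" "L 3 p q = L 3 p' q'"
    have "row p q = row p' q'"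
      using row_eq[of "row p q" "row p' q'" 2 3] row[OF pq(1,2)] row[OF pq(3,4)]
        L[OF _ pq(1,2,5), of 2] L[OF _ pq(1,2,5), of 3] L[OF _ pq(3,4,6), of 2] L[OF _ pq(3,4,6), of 3] pq(7,8)
      by simp
    then show "p = p' \<and> q = q'" using row_inj pq by blast
  qed simp_all
qed

end

theorem no_OA_4_6: "\<not> has_OA 4 6"
proof
  assume "has_OA 4 6"
  then obtain w :: "nat \<times> nat \<Rightarrow> nat \<Rightarrow> nat" where "OA 4 {..<6} ({..<6} \<times> {..<6}) w"
    by (auto simp: has_OA_def)
  then interpret OA_4_6 "{..<6} \<times> {..<6}" w by unfold_locales
  obtain Y where "\<And>i. i < 4 \<Longrightarrow> Y i \<subseteq> {..<6} \<and> card (Y i) = 2"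
    "\<And>r. r \<in> {..<6} \<times> {..<6} \<Longrightarrow> card {i. i < 4 \<and> w r i \<in> Y i} \<in> {0, 2}"
    by (rule ex_balanced) blast
  then interpret balanced "{..<6} \<times> {..<6}" w Y by unfold_locales
  show False by (rule contradiction)
qed

text \<open>
  For each pair of columns exactly one pair of symbols is missing, and its two members are the only
  symbols occurring less than \<open>n\<close> times in their columns. Hence the missing pairs fit together
  to one further row.
\<close>

lemma has_OA_if_one_row_missing:
  assumes w: "packing k A R w" and k: "2 \<le> k" and A: "finite A" "card A = n"
    and R: "Suc (card R) = n\<^sup>2"
  shows "has_OA k n"
proof -
  have fin: "finite R" using packing_card_le[OF w k A(1)] by blast
  have "n > 0" using R by (cases n) auto
  define im where "im i j = (\<lambda>r. (w r i, w r j)) ` R" for i j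
  define rare where "rare i = {a \<in> A. card {r \<in> R. w r i = a} \<noteq> n}" for i
  have miss: "\<exists>p q. A \<times> A - im i j = {(p, q)} \<and> rare i = {p}"
    if ij: "i < k" "j < k" "i \<noteq> j" for i j
  proof -
    have inj: "inj_on (\<lambda>r. (w r i, w r j)) R" and sub: "im i j \<subseteq> A \<times> A"
      using w ij by (auto simp: packing_def im_def)
    have "card (im i j) = card R" unfolding im_def by (rule card_image[OF inj])
    then have "card (A \<times> A - im i j) = 1"
      using R A sub by (subst card_Diff_subset) (auto simp: card_cartesian_product power2_eq_square finite_subset)
    then obtain p q where pq: "A \<times> A - im i j = {(p, q)}" by (metis card_1_singletonE prod.exhaust)
    have "card {r \<in> R. w r i = a} = card ({a} \<times> A - {(p, q)})" if "a \<in> A" for a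
    proof -
      have "inj_on (\<lambda>r. (w r i, w r j)) {r \<in> R. w r i = a}"
        using inj by (rule inj_on_subset) auto
      moreover have "(\<lambda>r. (w r i, w r j)) ` {r \<in> R. w r i = a} = im i j \<inter> {a} \<times> A"
        using sub by (auto simp: im_def)
      moreover have "im i j \<inter> {a} \<times> A = {a} \<times> A - {(p, q)}"
        unfolding pq[symmetric] using that by blast
      ultimately show ?thesis by (metis (no_types, lifting) card_image)
    qed
    moreover have "card ({a} \<times> A - {(p, q)}) = (if a = p then n - 1 else n)" for a
      using A pq by (auto simp: card_cartesian_product card_Diff_singleton_if)
    ultimately have cnt: "card {r \<in> R. w r i = a} = (if a = p then n - 1 else n)" if "a \<in> A" for a
      using that by simp
    have "p \<in> A" using pq by blast
    moreover have "a \<in> rare i \<longleftrightarrow> a \<in> A \<and> a = p" for a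
      using cnt[of a] \<open>n > 0\<close> unfolding rare_def by (cases "a = p") auto
    ultimately have "rare i = {p}" by blast
    then show ?thesis using pq by blast
  qed
  have swap: "(b, a) \<in> im j i \<longleftrightarrow> (a, b) \<in> im i j" for i j a b by (auto simp: im_def)
  \<comment> \<open>\<open>rare i\<close> refers to column \<open>i\<close> alone, so the missing
    symbol is the same for every partner column.\<close>
  define d where "d i = the_elem (rare i)" for i
  have missing: "A \<times> A - im i j = {(d i, d j)}" if ij: "i < k" "j < k" "i \<noteq> j" for i j
  proof -
    obtain p q where pq: "A \<times> A - im i j = {(p, q)}" "rare i = {p}" using miss[OF ij] by blast
    obtain q' p' where qp: "A \<times> A - im j i = {(q', p')}" "rare j = {q'}"
      using miss[of j i] ij by blast
    have "(q, p) \<in> A \<times> A - im j i" using pq(1) swap[of q p j i] by blast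
    then show ?thesis using pq qp by (simp add: d_def)
  qed
  define v where "v r i = (case r of None \<Rightarrow> d i | Some r \<Rightarrow> w r i)" for r i
  let ?R = "insert None (Some ` R)"
  have "packing k A ?R v"
  proof (rule packingI)
    fix r i assume r: "r \<in> ?R" and i: "i < k"
    obtain j where "j < k" "i \<noteq> j" using k i by (metis One_nat_def Suc_1 Suc_le_lessD less_trans n_not_Suc_n zero_less_Suc)
    then have "d i \<in> A" using missing[of i j] i by blast
    then show "v r i \<in> A" using r packing_mem[OF w _ i] by (auto simp: v_def)
  next
    fix i j r r' assume ij: "i < j" "j < k" and r: "r \<in> ?R" "r' \<in> ?R" and eq: "v r i = v r' i" "v r j = v r' j"
    have ij': "i < k" "j < k" "i \<noteq> j" using ij by auto
    have new: "\<not> (w x i = d i \<and> w x j = d j)" if "x \<in> R" for x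
    proof
      assume "w x i = d i \<and> w x j = d j"
      then have "(d i, d j) \<in> im i j" using that by (force simp: im_def)
      then show False using missing[OF ij'] by blast
    qed
    show "r = r'"
    proof (cases r; cases r')
      fix x x' assume "r = Some x" "r' = Some x'"
      then show ?thesis using r eq packing_eq[OF w ij', of x x'] by (auto simp: v_def)
    next
      fix x assume "r = Some x" "r' = None"
      then show ?thesis using r eq new[of x] by (auto simp: v_def)
    next
      fix x assume "r = None" "r' = Some x"
      then show ?thesis using r eq new[of x] by (auto simp: v_def)
    qed simp
  qed
  moreover have "card ?R = n\<^sup>2" using R fin by (simp add: card_image)
  ultimately show ?thesis using k A by (intro has_OA_packing)
qed

lemma packing_6_le:
  assumes "packing 4 A R w" "finite A" "card A = 6"
  shows "card R \<le> 34"
proof (rule ccontr)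
  assume "\<not> card R \<le> 34"
  moreover have "card R \<le> 36" using packing_card_le(2)[OF assms(1) _ assms(2)] assms(3) by simp
  ultimately have "card R = 6\<^sup>2 \<or> Suc (card R) = 6\<^sup>2" by auto
  then show False
    using no_OA_4_6 has_OA_packing[OF assms(1) _ assms(2,3)] has_OA_if_one_row_missing[OF assms(1) _ assms(2,3)]
    by auto
qed

section \<open>Codes for the network\<close>

lemma net5_sel: "source net5 = S" "terminals net5 = {T1, T2, T3, T4, T5}"
  by (simp_all add: net5_def)

lemma filter_insert_if:
  "{x. x \<in> insert a B \<and> P x} = (if P a then insert a {x. x \<in> B \<and> P x} else {x. x \<in> B \<and> P x})"
  by auto

lemma in_arcs_net5:
  "in_arcs (graph net5) V1 = {(S, V1)}" "in_arcs (graph net5) V2 = {(S, V2)}"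
  "in_arcs (graph net5) V3 = {(V1, V3), (V2, V3)}" "in_arcs (graph net5) V4 = {(V1, V4), (V2, V4)}"
  "in_arcs (graph net5) V5 = {(V3, V5)}" "in_arcs (graph net5) V6 = {(V4, V6)}"
  "in_arcs (graph net5) T1 = {(V1, T1), (V5, T1)}" "in_arcs (graph net5) T2 = {(V1, T2), (V6, T2)}"
  "in_arcs (graph net5) T3 = {(V5, T3), (V6, T3)}" "in_arcs (graph net5) T4 = {(V2, T4), (V5, T4)}"
  "in_arcs (graph net5) T5 = {(V2, T5), (V6, T5)}"
  by (simp_all add: in_arcs_def net5_def filter_insert_if del: insert_iff)

lemma out_arcs_net5:
  "out_arcs (graph net5) S = {(S, V1), (S, V2)}"
  "out_arcs (graph net5) V1 = {(V1, V3), (V1, V4), (V1, T1), (V1, T2)}"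
  "out_arcs (graph net5) V2 = {(V2, V3), (V2, V4), (V2, T4), (V2, T5)}"
  "out_arcs (graph net5) V3 = {(V3, V5)}" "out_arcs (graph net5) V4 = {(V4, V6)}"
  "out_arcs (graph net5) V5 = {(V5, T1), (V5, T3), (V5, T4)}"
  "out_arcs (graph net5) V6 = {(V6, T2), (V6, T3), (V6, T5)}"
  by (simp_all add: out_arcs_def net5_def filter_insert_if del: insert_iff)

section \<open>Unambiguous pairs and packings\<close>

lemma edge_symbols_source:
  "edge_symbols net5 F x (S, V1) = x (S, V1)" "edge_symbols net5 F x (S, V2) = x (S, V2)"
  using carries_edge_symbols[OF is_network_net5, of F x]
  by (auto simp: carries_def net5_sel out_arcs_net5)

lemma edge_symbols_out:
  assumes "V \<in> {V1, V2, V3, V4, V5, V6}" "e \<in> out_arcs (graph net5) V"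
  shows "edge_symbols net5 F x e = F V (restrict (edge_symbols net5 F x) (in_arcs (graph net5) V)) e"
  using carries_edge_symbols[OF is_network_net5, of F x] assms
  unfolding carries_def intermediate_net5 by blast

lemma edge_symbols_mem:
  assumes "F \<in> network_codes net5 A" "V \<in> {V1, V2, V3, V4, V5, V6}" "e \<in> out_arcs (graph net5) V"
    and "\<And>e'. e' \<in> in_arcs (graph net5) V \<Longrightarrow> edge_symbols net5 F x e' \<in> A"
  shows "edge_symbols net5 F x e \<in> A"
proof -
  let ?in = "in_arcs (graph net5) V"
  have "F V \<in> (?in \<rightarrow>\<^sub>E A) \<rightarrow>\<^sub>E (out_arcs (graph net5) V \<rightarrow>\<^sub>E A)"
    using assms(1,2) unfolding network_codes_def intermediate_net5 by (rule PiE_mem)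
  moreover have "restrict (edge_symbols net5 F x) ?in \<in> ?in \<rightarrow>\<^sub>E A" using assms(4) by auto
  ultimately have "F V (restrict (edge_symbols net5 F x) ?in) \<in> out_arcs (graph net5) V \<rightarrow>\<^sub>E A"
    by (rule PiE_mem)
  then show ?thesis unfolding edge_symbols_out[OF assms(2,3)] using assms(3) by (rule PiE_mem)
qed

lemma edge_symbols_cong:
  assumes "V \<in> {V1, V2, V3, V4, V5, V6}" "e \<in> out_arcs (graph net5) V"
    and "\<And>e'. e' \<in> in_arcs (graph net5) V \<Longrightarrow> edge_symbols net5 F x e' = edge_symbols net5 F y e'"
  shows "edge_symbols net5 F x e = edge_symbols net5 F y e"
proof -
  have "restrict (edge_symbols net5 F x) (in_arcs (graph net5) V) =
      restrict (edge_symbols net5 F y) (in_arcs (graph net5) V)"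
    using assms(3) by (rule restrict_ext)
  then show ?thesis using edge_symbols_out[OF assms(1,2)] by metis
qed

text \<open>\<open>V1\<close>, \<open>V2\<close>, \<open>V5\<close>, \<open>V6\<close> have one
  incoming edge each, so under any network code all their outputs are functions of that one symbol.
  Agreement in two coordinates therefore reaches all incoming edges of a terminal, except for the
  two source coordinates.\<close>

lemma unambiguous_packing:
  assumes "unambiguous net5 A C F"
  obtains w where "packing 4 A C w"
proof -
  let ?s = "edge_symbols net5 F"
  have C: "C \<subseteq> {(S, V1), (S, V2)} \<rightarrow>\<^sub>E A" and F: "F \<in> network_codes net5 A"
    and inj: "\<And>T. T \<in> {T1, T2, T3, T4, T5} \<Longrightarrow> inj_on (transfer net5 F T) C"
    using assms by (auto simp: unambiguous_def outer_code_def net5_sel out_arcs_net5)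
  define w where "w x i = (if i = 0 then ?s x (S, V1) else if i = 1 then ?s x (S, V2)
     else if i = 2 then ?s x (V3, V5) else ?s x (V4, V6))" for x and i :: nat
  have mem: "?s x (S, V1) \<in> A \<and> ?s x (S, V2) \<in> A \<and> ?s x (V3, V5) \<in> A \<and> ?s x (V4, V6) \<in> A"
    if "x \<in> C" for x
  proof -
    have src: "?s x (S, V1) \<in> A" "?s x (S, V2) \<in> A"
      using C that by (auto simp: edge_symbols_source)
    have 1: "?s x e \<in> A" if "e \<in> out_arcs (graph net5) V1" for e
      by (rule edge_symbols_mem[OF F _ that]) (use src in \<open>auto simp: in_arcs_net5\<close>)
    have 2: "?s x e \<in> A" if "e \<in> out_arcs (graph net5) V2" for e
      by (rule edge_symbols_mem[OF F _ that]) (use src in \<open>auto simp: in_arcs_net5\<close>)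
    have "?s x (V3, V5) \<in> A"
      by (rule edge_symbols_mem[OF F, of V3]) (use 1 2 in \<open>auto simp: in_arcs_net5 out_arcs_net5\<close>)
    moreover have "?s x (V4, V6) \<in> A"
      by (rule edge_symbols_mem[OF F, of V4]) (use 1 2 in \<open>auto simp: in_arcs_net5 out_arcs_net5\<close>)
    ultimately show ?thesis using src by simp
  qed
  have eqI: "x = y" if "x \<in> C" "y \<in> C" "T \<in> {T1, T2, T3, T4, T5}"
    "\<And>e. e \<in> in_arcs (graph net5) T \<Longrightarrow> ?s x e = ?s y e" for x y T
  proof -
    have "transfer net5 F T x = transfer net5 F T y"
      unfolding transfer_def using that(4) by (rule restrict_ext)
    then show ?thesis using inj[OF that(3)] that(1,2) by (auto dest: inj_onD)
  qed
  have c1: "?s x e = ?s y e" if "w x 0 = w y 0" "e \<in> out_arcs (graph net5) V1" for x y e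
    by (rule edge_symbols_cong[OF _ that(2)]) (use that(1) in \<open>auto simp: in_arcs_net5 w_def\<close>)
  have c2: "?s x e = ?s y e" if "w x 1 = w y 1" "e \<in> out_arcs (graph net5) V2" for x y e
    by (rule edge_symbols_cong[OF _ that(2)]) (use that(1) in \<open>auto simp: in_arcs_net5 w_def\<close>)
  have c5: "?s x e = ?s y e" if "w x 2 = w y 2" "e \<in> out_arcs (graph net5) V5" for x y e
    by (rule edge_symbols_cong[OF _ that(2)]) (use that(1) in \<open>auto simp: in_arcs_net5 w_def\<close>)
  have c6: "?s x e = ?s y e" if "w x 3 = w y 3" "e \<in> out_arcs (graph net5) V6" for x y e
    by (rule edge_symbols_cong[OF _ that(2)]) (use that(1) in \<open>auto simp: in_arcs_net5 w_def\<close>)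
  have "packing 4 A C w"
  proof (rule packingI)
    show "w x i \<in> A" if "x \<in> C" for x i using mem[OF that] by (simp add: w_def)
  next
    fix i j x y
    assume ij: "i < j" "j < 4" and xy: "x \<in> C" "y \<in> C" and eq: "w x i = w y i" "w x j = w y j"
    have "(i, j) \<in> {(0, 1), (0, 2), (0, 3), (1, 2), (1, 3), (2, 3)}"
      using ij by (auto simp: numeral_eq_Suc less_Suc_eq)
    then consider "i = 0" "j = 1" | "i = 0" "j = 2" | "i = 0" "j = 3" | "i = 1" "j = 2"
      | "i = 1" "j = 3" | "i = 2" "j = 3" by auto
    then show "x = y"
    proof cases
      case 1
      then have "x e = y e" if "e \<in> {(S, V1), (S, V2)}" for e
        using that eq by (auto simp: w_def edge_symbols_source)
      then show ?thesis by (rule PiE_ext[OF subsetD[OF C xy(1)] subsetD[OF C xy(2)]])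
    next
      case 2
      show ?thesis
      proof (rule eqI[OF xy, of T1])
        fix e assume "e \<in> in_arcs (graph net5) T1"
        then show "?s x e = ?s y e"
          using c1[OF eq(1)[unfolded 2], of e] c5[OF eq(2)[unfolded 2], of e]
          by (auto simp: in_arcs_net5 out_arcs_net5)
      qed simp
    next
      case 3
      show ?thesis
      proof (rule eqI[OF xy, of T2])
        fix e assume "e \<in> in_arcs (graph net5) T2"
        then show "?s x e = ?s y e"
          using c1[OF eq(1)[unfolded 3], of e] c6[OF eq(2)[unfolded 3], of e]
          by (auto simp: in_arcs_net5 out_arcs_net5)
      qed simp
    next
      case 4
      show ?thesis
      proof (rule eqI[OF xy, of T4])
        fix e assume "e \<in> in_arcs (graph net5) T4"
        then show "?s x e = ?s y e"
          using c2[OF eq(1)[unfolded 4], of e] c5[OF eq(2)[unfolded 4], of e]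
          by (auto simp: in_arcs_net5 out_arcs_net5)
      qed simp
    next
      case 5
      show ?thesis
      proof (rule eqI[OF xy, of T5])
        fix e assume "e \<in> in_arcs (graph net5) T5"
        then show "?s x e = ?s y e"
          using c2[OF eq(1)[unfolded 5], of e] c6[OF eq(2)[unfolded 5], of e]
          by (auto simp: in_arcs_net5 out_arcs_net5)
      qed simp
    next
      case 6
      show ?thesis
      proof (rule eqI[OF xy, of T3])
        fix e assume "e \<in> in_arcs (graph net5) T3"
        then show "?s x e = ?s y e"
          using c5[OF eq(1)[unfolded 6], of e] c6[OF eq(2)[unfolded 6], of e]
          by (auto simp: in_arcs_net5 out_arcs_net5)
      qed simp
    qed
  qed
  then show ?thesis by (rule that)
qed

lemma packing_unambiguous:
  assumes w: "packing 4 A R w" and "R \<noteq> {}"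
  obtains C F where "unambiguous net5 A C F" "card C = card R"
proof -
  obtain r0 where r0: "r0 \<in> R" using assms(2) by blast
  \<comment> \<open>Looks up the row with first symbols \<open>a\<close>, \<open>b\<close>. Other
    pairs get the entries of \<open>r0\<close>, so that the vertex functions have values in
    \<open>A\<close>.\<close>
  define get where "get a b i = (if \<exists>r\<in>R. w r 0 = a \<and> w r 1 = b
     then w (SOME r. r \<in> R \<and> w r 0 = a \<and> w r 1 = b) i else w r0 i)" for a b i
  have get: "get (w r 0) (w r 1) i = w r i" if r: "r \<in> R" for r i
  proof -
    have "(SOME r'. r' \<in> R \<and> w r' 0 = w r 0 \<and> w r' 1 = w r 1) = r"
      using r packing_eq[OF w, of 0 1 _ r] by (intro some_equality) auto
    then show ?thesis using r by (auto simp: get_def)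
  qed
  have get_mem: "get a b i \<in> A" if "i < 4" for a b i
  proof (cases "\<exists>r. r \<in> R \<and> w r 0 = a \<and> w r 1 = b")
    case True
    from someI_ex[OF this] show ?thesis using packing_mem[OF w _ that] True by (auto simp: get_def)
  next
    case False
    then show ?thesis using packing_mem[OF w r0 that] by (auto simp: get_def)
  qed
  define val where "val V x = (case V of
      V1 \<Rightarrow> x (S, V1) | V2 \<Rightarrow> x (S, V2) | V3 \<Rightarrow> get (x (V1, V3)) (x (V2, V3)) 2
    | V4 \<Rightarrow> get (x (V1, V4)) (x (V2, V4)) 3 | V5 \<Rightarrow> x (V3, V5) | V6 \<Rightarrow> x (V4, V6))"
    for V and x :: "vertex \<times> vertex \<Rightarrow> 'a"
  define F where "F = (\<lambda>V\<in>{V1, V2, V3, V4, V5, V6}. \<lambda>x\<in>in_arcs (graph net5) V \<rightarrow>\<^sub>E A.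
    \<lambda>e\<in>out_arcs (graph net5) V. val V x)"
  have val_mem: "val V x \<in> A" if "V \<in> {V1, V2, V3, V4, V5, V6}" "x \<in> in_arcs (graph net5) V \<rightarrow>\<^sub>E A" for V x
    using that get_mem by (auto simp: val_def in_arcs_net5)
  have F: "F \<in> network_codes net5 A"
    unfolding network_codes_def intermediate_net5 F_def
    by (intro restrict_PiE_iff[THEN iffD2] ballI val_mem)
  define c where "c r = (\<lambda>e\<in>{(S, V1), (S, V2)}. if e = (S, V1) then w r 0 else w r 1)" for r
  let ?s = "\<lambda>r. edge_symbols net5 F (c r)"
  have out: "?s r e = val V (restrict (?s r) (in_arcs (graph net5) V))"
    if "V \<in> {V1, V2, V3, V4, V5, V6}" "e \<in> out_arcs (graph net5) V"
      "\<And>e'. e' \<in> in_arcs (graph net5) V \<Longrightarrow> ?s r e' \<in> A" for r V e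
  proof -
    have "restrict (?s r) (in_arcs (graph net5) V) \<in> in_arcs (graph net5) V \<rightarrow>\<^sub>E A"
      using that(3) by auto
    then show ?thesis
      unfolding edge_symbols_out[OF that(1,2)] using that(1,2) by (simp add: F_def)
  qed
  have src: "?s r (S, V1) = w r 0" "?s r (S, V2) = w r 1" for r
    by (simp_all add: edge_symbols_source c_def)
  have s1: "?s r e = w r 0" if "r \<in> R" "e \<in> out_arcs (graph net5) V1" for r e
    using out[OF _ that(2)] packing_mem[OF w that(1)] by (simp add: src in_arcs_net5 val_def)
  have s2: "?s r e = w r 1" if "r \<in> R" "e \<in> out_arcs (graph net5) V2" for r e
    using out[OF _ that(2)] packing_mem[OF w that(1)] by (simp add: src in_arcs_net5 val_def)
  have s12: "?s r (V1, V3) = w r 0" "?s r (V1, V4) = w r 0" "?s r (V2, V3) = w r 1" "?s r (V2, V4) = w r 1"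
    if "r \<in> R" for r
    using s1[OF that] s2[OF that] by (simp_all add: out_arcs_net5)
  have s3: "?s r (V3, V5) = w r 2" if "r \<in> R" for r
  proof -
    have "?s r e \<in> A" if "e \<in> in_arcs (graph net5) V3" for e
      using that packing_mem[OF w \<open>r \<in> R\<close>] by (auto simp: in_arcs_net5 s12[OF \<open>r \<in> R\<close>])
    then have "?s r (V3, V5) = val V3 (restrict (?s r) (in_arcs (graph net5) V3))"
      by (intro out) (simp_all add: out_arcs_net5)
    then show ?thesis by (simp add: in_arcs_net5 val_def s12[OF that] get[OF that, unfolded One_nat_def])
  qed
  have s4: "?s r (V4, V6) = w r 3" if "r \<in> R" for r
  proof -
    have "?s r e \<in> A" if "e \<in> in_arcs (graph net5) V4" for e
      using that packing_mem[OF w \<open>r \<in> R\<close>] by (auto simp: in_arcs_net5 s12[OF \<open>r \<in> R\<close>])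
    then have "?s r (V4, V6) = val V4 (restrict (?s r) (in_arcs (graph net5) V4))"
      by (intro out) (simp_all add: out_arcs_net5)
    then show ?thesis by (simp add: in_arcs_net5 val_def s12[OF that] get[OF that, unfolded One_nat_def])
  qed
  have s5: "?s r e = w r 2" if "r \<in> R" "e \<in> out_arcs (graph net5) V5" for r e
    using out[OF _ that(2)] packing_mem[OF w that(1)] by (simp add: s3[OF that(1)] in_arcs_net5 val_def)
  have s6: "?s r e = w r 3" if "r \<in> R" "e \<in> out_arcs (graph net5) V6" for r e
    using out[OF _ that(2)] packing_mem[OF w that(1)] by (simp add: s4[OF that(1)] in_arcs_net5 val_def)
  have inj: "r = r'" if r: "r \<in> R" "r' \<in> R" and T: "T \<in> {T1, T2, T3, T4, T5}"
    and eq: "transfer net5 F T (c r) = transfer net5 F T (c r')" for T r r'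
  proof -
    have eq': "?s r e = ?s r' e" if "e \<in> in_arcs (graph net5) T" for e
      using fun_cong[OF eq, of e] that by (simp add: transfer_def)
    note s = s1[OF r(1)] s2[OF r(1)] s5[OF r(1)] s6[OF r(1)] s1[OF r(2)] s2[OF r(2)] s5[OF r(2)] s6[OF r(2)]
    have p: "r = r'" if "i < 4" "j < 4" "i \<noteq> j" "w r i = w r' i" "w r j = w r' j" for i j
      using packing_eq[OF w that(1-3) r that(4,5)] .
    consider "T = T1" | "T = T2" | "T = T3" | "T = T4" | "T = T5" using T by auto
    then show ?thesis
    proof cases
      case 1
      then show ?thesis using eq'[of "(V1, T1)"] eq'[of "(V5, T1)"] p[of 0 2]
        by (simp add: in_arcs_net5 out_arcs_net5 s)
    next
      case 2
      then show ?thesis using eq'[of "(V1, T2)"] eq'[of "(V6, T2)"] p[of 0 3]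
        by (simp add: in_arcs_net5 out_arcs_net5 s)
    next
      case 3
      then show ?thesis using eq'[of "(V5, T3)"] eq'[of "(V6, T3)"] p[of 2 3]
        by (simp add: in_arcs_net5 out_arcs_net5 s)
    next
      case 4
      then show ?thesis using eq'[of "(V2, T4)"] eq'[of "(V5, T4)"] p[of 1 2]
        by (simp add: in_arcs_net5 out_arcs_net5 s)
    next
      case 5
      then show ?thesis using eq'[of "(V2, T5)"] eq'[of "(V6, T5)"] p[of 1 3]
        by (simp add: in_arcs_net5 out_arcs_net5 s)
    qed
  qed
  have "unambiguous net5 A (c ` R) F"
    unfolding unambiguous_def outer_code_def net5_sel out_arcs_net5
  proof (intro conjI ballI)
    show "c ` R \<noteq> {}" using assms(2) by simp
    show "c ` R \<subseteq> {(S, V1), (S, V2)} \<rightarrow>\<^sub>E A" using packing_mem[OF w]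
      unfolding c_def by (intro image_subsetI restrict_PiE_iff[THEN iffD2] ballI) simp
    show "F \<in> network_codes net5 A" by (rule F)
    show "inj_on (transfer net5 F T) (c ` R)" if "T \<in> {T1, T2, T3, T4, T5}" for T
      using inj[OF _ _ that] by (auto intro!: inj_onI)
  qed
  \<comment> \<open>Equal codewords have equal transfers to \<open>T1\<close>, so \<open>inj\<close>
    applies.\<close>
  moreover have "inj_on c R"
    using inj[of _ _ T1] by (auto intro!: inj_onI)
  then have "card (c ` R) = card R" by (rule card_image)
  ultimately show ?thesis by (rule that)
qed

text \<open>\<open>upper\<close> concerns packings indexed by codewords, as
  \<open>unambiguous_packing\<close> provides them, since a hypothesis cannot be polymorphic in the
  row type.\<close>

lemma capacity_net5:
  fixes A :: "'a set"
  assumes A: "finite A" "2 \<le> card A"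
    and upper: "\<And>(C :: (vertex \<times> vertex \<Rightarrow> 'a) set) v. packing 4 A C v \<Longrightarrow> card C \<le> N"
    and lower: "packing 4 A R w" "card R = N" "0 < N"
  shows "capacity net5 A = log (card A) N"
  unfolding capacity_def
proof (rule Max_eqI)
  show "finite (achievable_rates net5 A)" by (rule achievable_rates_finite[OF is_network_net5 A(1)])
next
  fix y assume "y \<in> achievable_rates net5 A"
  then obtain C F where C: "unambiguous net5 A C F" "y = log (card A) (card C)"
    by (auto simp: achievable_rates_def)
  obtain v where v: "packing 4 A C v" by (rule unambiguous_packing[OF C(1)])
  have "finite C" using packing_card_le(1)[OF v _ A(1)] by simp
  moreover have "C \<noteq> {}" using C(1) by (simp add: unambiguous_def outer_code_def)
  ultimately have "0 < card C" by (simp add: card_gt_0_iff)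
  then show "y \<le> log (card A) N" using C(2) upper[OF v] A(2) by simp
next
  have "R \<noteq> {}" using lower by auto
  from packing_unambiguous[OF lower(1) this] show "log (card A) N \<in> achievable_rates net5 A"
    unfolding achievable_rates_def using lower(2) by (metis (mono_tags, lifting) mem_Collect_eq)
qed

lemma packing_relabel:
  assumes "packing k A R w" "inj_on g A" "g ` A \<subseteq> B"
  shows "packing k B R (\<lambda>r i. g (w r i))"
proof (rule packingI)
  show "g (w r i) \<in> B" if "r \<in> R" "i < k" for r i
    using packing_mem[OF assms(1) that] assms(3) by blast
  fix i j r r'
  assume ij: "i < j" "j < k" and r: "r \<in> R" "r' \<in> R"
    and eq: "g (w r i) = g (w r' i)" "g (w r j) = g (w r' j)"
  have ij': "i < k" "j < k" "i \<noteq> j" using ij by auto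
  have "w r i = w r' i" "w r j = w r' j"
    using eq inj_onD[OF assms(2)] packing_mem[OF assms(1)] r ij' by blast+
  then show "r = r'" by (rule packing_eq[OF assms(1) ij' r])
qed

theorem theorem5:
  fixes A :: "'a set"
  assumes "finite A" and "card A \<ge> 2"
  shows "capacity net5 A =
    (if card A = 2 then 1 else if card A = 6 then log 6 34 else 2)"
proof -
  note cap = capacity_net5[OF assms]
  consider "card A = 2" | "card A = 6" | "card A > 2" "card A \<noteq> 6" using assms(2) by linarith
  then show ?thesis
  proof cases
    case 1
    have "finite {0..<2 :: nat}" "card A = card {0..<2 :: nat}" using 1 by simp_all
    then obtain g where g: "bij_betw g {0..<2 :: nat} A"
      using assms(1) by (metis finite_same_card_bij)
    have "packing 4 A {..<2} (\<lambda>r i. g r)"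
      using packing_relabel[OF packing_2_2, of g A 4] g by (simp add: bij_betw_def)
    from cap[OF packing_2_le[OF _ 1] this] have "capacity net5 A = log (card A) 2" by simp
    then show ?thesis using 1 by simp
  next
    case 2
    have "finite {0..<6 :: int}" "card A = card {0..<6 :: int}" using 2 by simp_all
    then obtain g where g: "bij_betw g {0..<6 :: int} A"
      using assms(1) by (metis finite_same_card_bij)
    obtain w :: "nat \<Rightarrow> nat \<Rightarrow> int" where w: "packing 4 {0..<6} {..<34} w"
      using packing_6_34 by blast
    have "packing 4 A {..<34} (\<lambda>r i. g (w r i))"
      using packing_relabel[OF w, of g A] g by (simp add: bij_betw_def)
    from cap[OF packing_6_le[OF _ assms(1) 2] this] have "capacity net5 A = log (card A) 34" by simp
    then show ?thesis using 2 by simp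
  next
    case 3
    obtain w where w: "OA 4 A ({..<card A} \<times> {..<card A}) w"
      using has_OA_E[OF has_OA_exists[OF 3] assms(1) refl] .
    have "card C \<le> (card A)\<^sup>2" if "packing 4 A C v" for C :: "(vertex \<times> vertex \<Rightarrow> 'a) set" and v
      by (rule packing_card_le(2)[OF that _ assms(1)]) simp
    from cap[OF this OA_imp_packing[OF w]]
    have "capacity net5 A = log (card A) ((card A)\<^sup>2)"
      using 3(1) by (simp add: card_cartesian_product power2_eq_square)
    then show ?thesis using 3 by (simp add: log_nat_power)
  qed
qed

end
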